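(* Let $n \geq 3$ be an integer and let $\alpha,\beta \in \mathbb{R}$. (1) The entrywise function $\Psi_{\alpha,\beta}$ preserves Loewner positivity on $\mathbb{P}_n(\mathbb{C})$ if $\beta \in \mathbb{Z}$, $(\alpha,\beta) \neq (0,0)$, and either $\alpha \in |\beta| - 2 + 2\mathbb{N}$ or $\alpha \geq \max(n-2, |\beta| + 2n - 6)$. (2) The entrywise function $\Psi_{\alpha,\beta}$ fails to preserve Loewner positivity on $\mathbb{P}_n(\mathbb{C})$ if any one of the following holds: (a) $\beta \notin \mathbb{Z}$; or (b) $\alpha < 1$; or (c) $1 \leq \alpha < \max\left(n-2, |\beta| + 2\lfloor (\sqrt{8n+1}-5)/2 \rfloor\right)$ and $\alpha \notin |\beta| - 2 + 2\mathbb{N}$.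
   Context: $\mathbb{N} = \{1,2,3,\dots\}$, so $|\beta|-2+2\mathbb{N} = \{|\beta|, |\beta|+2, |\beta|+4, \dots\}$. $\mathbb{P}_n(\mathbb{C})$ denotes the set of $n \times n$ complex Hermitian positive semidefinite matrices. For $\alpha,\beta \in \mathbb{R}$, $\Psi_{\alpha,\beta}:\mathbb{C}\to\mathbb{C}$ is defined by $\Psi_{\alpha,\beta}(re^{i\theta}) := r^\alpha e^{i\beta\theta}$ for $r>0$, $\theta \in (-\pi,\pi]$, and $\Psi_{\alpha,\beta}(0) := 0$. For a matrix $A = (a_{st})$, $\Psi_{\alpha,\beta}[A] := (\Psi_{\alpha,\beta}(a_{st}))$ (entrywise application). "$\Psi_{\alpha,\beta}$ preserves Loewner positivity on $\mathbb{P}_n(\mathbb{C})$" means $\Psi_{\alpha,\beta}[A] \in \mathbb{P}_n(\mathbb{C})$ for all $A \in \mathbb{P}_n(\mathbb{C})$. *)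

theory Defs
  imports Complex_Main "Jordan_Normal_Form.Schur_Decomposition"
begin

(* In psd_cmats, (A *\<^sub>v v) \<bullet>c v = (\<Sum>i<n. (A v)_i * cnj (v_i)) is the quadratic form v* A v.
   Its imaginary part vanishes because A is Hermitian, so taking Re loses nothing. *)

definition hermitian_mat :: "complex mat \<Rightarrow> bool" where
  "hermitian_mat A \<longleftrightarrow> mat_adjoint A = A"

definition psd_cmats :: "nat \<Rightarrow> complex mat set" where
  "psd_cmats n = {A \<in> carrier_mat n n. hermitian_mat A \<and>
     (\<forall>v \<in> carrier_vec n. 0 \<le> Re ((A *\<^sub>v v) \<bullet>c v))}"

(* Arg is the principal argument, with values in (-pi, pi]. *)

definition Psi :: "real \<Rightarrow> real \<Rightarrow> complex \<Rightarrow> complex" where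
  "Psi \<alpha> \<beta> z = (if z = 0 then 0 else rcis (cmod z powr \<alpha>) (\<beta> * Arg z))"

lemma Psi_0 [simp]: "Psi \<alpha> \<beta> 0 = 0"
  by (simp add: Psi_def)

lemma Psi_polar:
  assumes "r > 0" and "- pi < \<theta>" and "\<theta> \<le> pi"
  shows "Psi \<alpha> \<beta> (of_real r * exp (\<i> * of_real \<theta>)) =
    of_real (r powr \<alpha>) * exp (\<i> * of_real (\<beta> * \<theta>))"
proof -
  have "Arg (rcis r \<theta>) = \<theta>"
    by (rule cis_Arg_unique) (use assms in \<open>auto simp: rcis_def sgn_mult sgn_of_real sgn_cis\<close>)
  moreover have "cmod (rcis r \<theta>) = r"
    using assms by simp
  moreover have "rcis r \<theta> \<noteq> 0"
    using assms by simp
  ultimately have "Psi \<alpha> \<beta> (rcis r \<theta>) = rcis (r powr \<alpha>) (\<beta> * \<theta>)"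
    by (simp add: Psi_def)
  then show ?thesis
    by (simp add: rcis_def cis_conv_exp)
qed

definition preserves_psd :: "(complex \<Rightarrow> complex) \<Rightarrow> nat \<Rightarrow> bool" where
  "preserves_psd f n \<longleftrightarrow> (\<forall>A \<in> psd_cmats n. map_mat f A \<in> psd_cmats n)"

end

theory Submission
  imports Defs "HOL-Analysis.Generalised_Binomial_Theorem"
begin

text \<open>
Why the theorem is true.

On the positive side, \<open>Psi \<alpha> \<beta>\<close> with integral \<open>\<beta>\<close> behaves like
\<open>z powr ((\<alpha> + \<beta>) / 2) * cnj z powr ((\<alpha> - \<beta>) / 2)\<close>.  For \<open>\<alpha> = \<bar>\<beta>\<bar> + 2 * j > 0\<close> this is a
monomial in \<open>z\<close> and \<open>cnj z\<close>, and the Schur product theorem (\<open>psd_kernel_schur_product\<close>) applies.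
For large \<open>\<alpha>\<close> the argument of FitzGerald and Horn works by induction on the size
(\<open>Psi_psd_kernel_step\<close>).  Subtract from \<open>K\<close> a rank-one kernel \<open>Z\<close> that agrees with \<open>K\<close> in one row
and column.  Since \<open>Psi\<close> is multiplicative it sends \<open>Z\<close> to a rank-one kernel.  Along the segment
from \<open>Z\<close> to \<open>K\<close>, the derivative of the entrywise image is a sum of Schur products of \<open>K - Z\<close> and its
conjugate with the images of a kernel with one row fewer under \<open>Psi (\<alpha> - 1) (\<beta> \<plusminus> 1)\<close>.
The exponent drops by one per step while \<open>\<bar>\<beta>\<bar>\<close> may grow by one, so the requirement on \<open>\<alpha>\<close> grows by
two with each further row beyond three; two-by-two kernels need only \<open>\<alpha> \<ge> 0\<close>.

On the negative side, a rank-one and a rank-two matrix give \<open>\<beta> \<in> \<int>\<close> and \<open>\<alpha> \<ge> 1\<close>.  Beyond that,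
consider matrices with entries \<open>1 + x * u s * cnj (u t)\<close> for small \<open>x > 0\<close>.  With
\<open>a = (\<alpha> + \<beta>) / 2\<close> and \<open>b = (\<alpha> - \<beta>) / 2\<close>, their image has a quadratic form with the expansion
\<open>\<Sum>l. x ^ l * (\<Sum>j + k = l. (a gchoose j) * (b gchoose k) * (cmod (\<Sum>s. v s * u s ^ j * cnj (u s) ^ k))\<^sup>2)\<close>.
If \<open>v\<close> kills all lower orders then the first surviving coefficient must be nonnegative
(\<open>leading_coefficient_nonneg\<close>).  Two choices of points matter.

First, take the \<open>(k + 1) * (k + 2) / 2\<close> points of a triangular lattice and let \<open>v\<close> be a discrete
version of the \<open>k\<close>-th power of the Cauchy--Riemann operator, which isolates the monomial \<open>cnj z ^ k\<close>.
This forces \<open>(b gchoose k) \<ge> 0\<close>.  If \<open>b\<close> is not a natural number and \<open>b < m\<close>, some \<open>k \<le> m + 1\<close>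
violates this, whence the bound with the triangular-number term
\<open>\<lfloor>(sqrt (8 * n + 1) - 5) / 2\<rfloor>\<close>.

Second, take the integers \<open>0, \<dots>, k\<close> with alternating binomial weights.  By Vandermonde's identity this
forces \<open>(\<alpha> gchoose k) \<ge> 0\<close> for all \<open>k < n\<close>, which excludes every nonintegral \<open>\<alpha> < n - 2\<close>.

What remains is an integer \<open>\<alpha>\<close> with \<open>\<alpha> - \<beta>\<close> odd, where on real entries \<open>Psi\<close> is \<open>x ^ \<alpha>\<close> for
\<open>x \<ge> 0\<close> and \<open>- (x ^ \<alpha>)\<close> for \<open>x < 0\<close>.  A real matrix \<open>1 + t s * t r\<close> with one negative entry above
the diagonal, together with weights that annihilate polynomials of degree \<open>\<alpha>\<close>, makes the quadratic
form collapse to that single entry, with a sign of our choosing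
(\<open>not_preserves_psd_Psi_wrong_parity\<close>).
\<close>

section \<open>Positive semidefinite kernels\<close>

text \<open>Positive semidefinite matrices indexed by an arbitrary set: principal submatrices are then
  restrictions to subsets, and counterexamples can be indexed by complex numbers.\<close>

definition hform :: "'a set \<Rightarrow> ('a \<Rightarrow> 'a \<Rightarrow> complex) \<Rightarrow> ('a \<Rightarrow> complex) \<Rightarrow> complex" where
  "hform I K x = (\<Sum>i\<in>I. \<Sum>j\<in>I. K i j * x j * cnj (x i))"

definition psd_kernel :: "'a set \<Rightarrow> ('a \<Rightarrow> 'a \<Rightarrow> complex) \<Rightarrow> bool" where
  "psd_kernel I K \<longleftrightarrow>
     (\<forall>i\<in>I. \<forall>j\<in>I. K j i = cnj (K i j)) \<and> (\<forall>x. 0 \<le> Re (hform I K x))"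

lemma psd_kernelI:
  assumes "\<And>i j. i \<in> I \<Longrightarrow> j \<in> I \<Longrightarrow> K j i = cnj (K i j)" and "\<And>x. 0 \<le> Re (hform I K x)"
  shows "psd_kernel I K"
  unfolding psd_kernel_def using assms by blast

lemma psd_kernel_herm: "psd_kernel I K \<Longrightarrow> i \<in> I \<Longrightarrow> j \<in> I \<Longrightarrow> K j i = cnj (K i j)"
  unfolding psd_kernel_def by blast

lemma psd_kernel_form: "psd_kernel I K \<Longrightarrow> 0 \<le> Re (hform I K x)"
  by (auto simp: psd_kernel_def)

lemma hform_cong:
  "(\<And>i j. i \<in> I \<Longrightarrow> j \<in> I \<Longrightarrow> K i j = L i j) \<Longrightarrow> hform I K x = hform I L x"
  unfolding hform_def by (intro sum.cong) auto

lemma psd_kernel_cong: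
  assumes "psd_kernel I K" and "\<And>i j. i \<in> I \<Longrightarrow> j \<in> I \<Longrightarrow> L i j = K i j"
  shows "psd_kernel I L"
proof (rule psd_kernelI)
  show "0 \<le> Re (hform I L x)" for x
    using hform_cong[of I L K x, OF assms(2)] psd_kernel_form[OF assms(1)] by simp
next
  fix i j assume "i \<in> I" "j \<in> I"
  then show "L j i = cnj (L i j)"
    using psd_kernel_herm[OF assms(1), of i j] assms(2) by simp
qed

lemma hform_subset:
  assumes "finite I" "J \<subseteq> I"
    and "\<And>i j. i \<in> I \<Longrightarrow> j \<in> I \<Longrightarrow> i \<notin> J \<or> j \<notin> J \<Longrightarrow> K i j * x j * cnj (x i) = 0"
  shows "hform I K x = hform J K x"
proof -
  have "(\<Sum>j\<in>I. K i j * x j * cnj (x i)) =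
        (if i \<in> J then (\<Sum>j\<in>J. K i j * x j * cnj (x i)) else 0)" if "i \<in> I" for i
  proof (cases "i \<in> J")
    case True
    have "(\<Sum>j\<in>I. K i j * x j * cnj (x i)) = (\<Sum>j\<in>J. K i j * x j * cnj (x i))"
      using assms that by (intro sum.mono_neutral_right) auto
    then show ?thesis using True by simp
  next
    case False
    then have "(\<Sum>j\<in>I. K i j * x j * cnj (x i)) = 0"
      using assms that by (intro sum.neutral) blast
    then show ?thesis using False by simp
  qed
  then have "hform I K x =
      (\<Sum>i\<in>I. if i \<in> J then (\<Sum>j\<in>J. K i j * x j * cnj (x i)) else 0)"
    unfolding hform_def by (intro sum.cong) auto
  also have "\<dots> = hform J K x"
    unfolding hform_def using assms(1,2)
    by (simp add: sum.If_cases Int_absorb1)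
  finally show ?thesis .
qed

lemma psd_kernel_subset:
  assumes "psd_kernel I K" "finite I" "J \<subseteq> I"
  shows "psd_kernel J K"
proof (rule psd_kernelI)
  fix x
  define y :: "'a \<Rightarrow> complex" where "y = (\<lambda>i. if i \<in> J then x i else 0)"
  have "hform I K y = hform J K y"
    using assms by (intro hform_subset) (auto simp: y_def)
  also have "\<dots> = hform J K x"
    unfolding hform_def y_def by (intro sum.cong) auto
  finally show "0 \<le> Re (hform J K x)"
    using psd_kernel_form[OF assms(1)] by metis
qed (use assms in \<open>auto intro: psd_kernel_herm\<close>)

lemma psd_kernel_insert_zero:
  assumes "psd_kernel J K" "finite J" and "\<And>i. K p i = 0" and "\<And>i. K i p = 0"
  shows "psd_kernel (insert p J) K"
proof (rule psd_kernelI)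
  fix x
  have "hform (insert p J) K x = hform J K x"
    using assms by (intro hform_subset) auto
  then show "0 \<le> Re (hform (insert p J) K x)"
    using psd_kernel_form[OF assms(1)] by simp
next
  fix i j assume "i \<in> insert p J" "j \<in> insert p J"
  then show "K j i = cnj (K i j)"
    using assms(3,4) psd_kernel_herm[OF assms(1), of i j] by (cases "i = p \<or> j = p") auto
qed

lemma hform_add: "hform I (\<lambda>i j. K i j + L i j) x = hform I K x + hform I L x"
  by (simp add: hform_def algebra_simps sum.distrib)

lemma hform_mult: "hform I (\<lambda>i j. c * K i j) x = c * hform I K x"
  by (simp add: hform_def sum_distrib_left mult.assoc)

lemma psd_kernel_add:
  "psd_kernel I K \<Longrightarrow> psd_kernel I L \<Longrightarrow> psd_kernel I (\<lambda>i j. K i j + L i j)"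
  by (rule psd_kernelI)
    (simp_all add: psd_kernel_form hform_add, metis psd_kernel_herm)

lemma psd_kernel_scale:
  "0 \<le> c \<Longrightarrow> psd_kernel I K \<Longrightarrow> psd_kernel I (\<lambda>i j. complex_of_real c * K i j)"
  by (rule psd_kernelI) (simp_all add: psd_kernel_form hform_mult, metis psd_kernel_herm)

lemma psd_kernel_cnj:
  assumes "psd_kernel I K"
  shows "psd_kernel I (\<lambda>i j. cnj (K i j))"
proof (rule psd_kernelI)
  fix x
  have "hform I (\<lambda>i j. cnj (K i j)) x = cnj (hform I K (\<lambda>i. cnj (x i)))"
    by (simp add: hform_def)
  then show "0 \<le> Re (hform I (\<lambda>i j. cnj (K i j)) x)"
    using psd_kernel_form[OF assms, of "\<lambda>i. cnj (x i)"] by simp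
qed (simp, metis psd_kernel_herm[OF assms])

lemma psd_kernel_diag_congruence:
  assumes "psd_kernel I K"
  shows "psd_kernel I (\<lambda>i j. \<zeta> i * cnj (\<zeta> j) * K i j)"
proof (rule psd_kernelI)
  fix x
  have "hform I (\<lambda>i j. \<zeta> i * cnj (\<zeta> j) * K i j) x = hform I K (\<lambda>i. cnj (\<zeta> i) * x i)"
    by (simp add: hform_def mult_ac)
  then show "0 \<le> Re (hform I (\<lambda>i j. \<zeta> i * cnj (\<zeta> j) * K i j) x)"
    using psd_kernel_form[OF assms] by simp
qed (simp, metis psd_kernel_herm[OF assms])

lemma hform_rank_one:
  "hform I (\<lambda>i j. \<zeta> i * cnj (\<zeta> j)) x = of_real ((cmod (\<Sum>i\<in>I. cnj (\<zeta> i) * x i))\<^sup>2)"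
proof -
  have "hform I (\<lambda>i j. \<zeta> i * cnj (\<zeta> j)) x =
      cnj (\<Sum>i\<in>I. cnj (\<zeta> i) * x i) * (\<Sum>i\<in>I. cnj (\<zeta> i) * x i)"
    unfolding hform_def cnj_sum sum_product by (intro sum.cong refl) simp
  then show ?thesis
    by (metis complex_norm_square mult.commute)
qed

lemma psd_kernel_rank_one: "psd_kernel I (\<lambda>i j. \<zeta> i * cnj (\<zeta> j))"
  by (rule psd_kernelI) (auto simp: hform_rank_one)

lemma psd_kernel_one: "psd_kernel I (\<lambda>i j. 1)"
  using psd_kernel_rank_one[of I "\<lambda>i. 1"] by simp

text \<open>The effect of changing one coordinate, from which the square in that coordinate can be
  completed.\<close>

lemma hform_shift:
  assumes "psd_kernel I K" "finite I" "p \<in> I"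
  shows "hform I K (\<lambda>i. x i + (if i = p then t else 0)) =
     hform I K x + cnj t * (\<Sum>j\<in>I. K p j * x j) + t * cnj (\<Sum>j\<in>I. K p j * x j) + K p p * t * cnj t"
proof -
  define e where "e = (\<lambda>i. if i = p then t else 0)"
  have A: "(\<Sum>i\<in>I. \<Sum>j\<in>I. K i j * x j * cnj (e i)) = cnj t * (\<Sum>j\<in>I. K p j * x j)"
  proof -
    have "(\<Sum>i\<in>I. \<Sum>j\<in>I. K i j * x j * cnj (e i)) =
          (\<Sum>i\<in>I. if i = p then cnj t * (\<Sum>j\<in>I. K p j * x j) else 0)"
      by (intro sum.cong) (auto simp: e_def sum_distrib_left mult_ac)
    then show ?thesis using assms(2,3) by simp
  qed
  have Ke: "(\<Sum>j\<in>I. K i j * e j * c) = K i p * t * c" for i c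
  proof -
    have "(\<Sum>j\<in>I. K i j * e j * c) = (\<Sum>j\<in>I. if j = p then K i p * t * c else 0)"
      by (intro sum.cong) (auto simp: e_def)
    then show ?thesis using assms(2,3) by simp
  qed
  have B: "(\<Sum>i\<in>I. \<Sum>j\<in>I. K i j * e j * cnj (x i)) = t * cnj (\<Sum>j\<in>I. K p j * x j)"
  proof -
    have "(\<Sum>i\<in>I. K i p * t * cnj (x i)) = (\<Sum>i\<in>I. t * cnj (K p i * x i))"
    proof (intro sum.cong refl)
      fix i assume "i \<in> I"
      then show "K i p * t * cnj (x i) = t * cnj (K p i * x i)"
        using psd_kernel_herm[OF assms(1), of p i] assms(3) by simp
    qed
    then show ?thesis by (simp add: Ke sum_distrib_left)
  qed
  have C: "(\<Sum>i\<in>I. \<Sum>j\<in>I. K i j * e j * cnj (e i)) = K p p * t * cnj t"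
  proof -
    have "(\<Sum>i\<in>I. K i p * t * cnj (e i)) = (\<Sum>i\<in>I. if i = p then K p p * t * cnj t else 0)"
      by (intro sum.cong) (auto simp: e_def)
    then show ?thesis using assms(2,3) by (simp add: Ke)
  qed
  have "hform I K (\<lambda>i. x i + e i) = hform I K x + (\<Sum>i\<in>I. \<Sum>j\<in>I. K i j * x j * cnj (e i))
     + (\<Sum>i\<in>I. \<Sum>j\<in>I. K i j * e j * cnj (x i)) + (\<Sum>i\<in>I. \<Sum>j\<in>I. K i j * e j * cnj (e i))"
    by (simp add: hform_def algebra_simps sum.distrib)
  then show ?thesis
    unfolding A B C by (simp add: e_def)
qed

lemma psd_kernel_diag:
  assumes "psd_kernel I K" "finite I" "p \<in> I"
  obtains d where "d \<ge> 0" "K p p = complex_of_real d"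
proof -
  have herm: "\<And>i j. i \<in> I \<Longrightarrow> j \<in> I \<Longrightarrow> K j i = cnj (K i j)"
    by (rule psd_kernel_herm[OF assms(1)])
  have im: "K p p = of_real (Re (K p p))"
    using herm[OF assms(3) assms(3)] by (metis Reals_cnj_iff of_real_Re)
  have "Re (hform I K (\<lambda>i. 0 + (if i = p then 1 else 0))) = Re (K p p)"
    using arg_cong[OF hform_shift[OF assms, where x = "\<lambda>i. 0" and t = 1], where f = Re]
    by (simp add: hform_def)
  then have "0 \<le> Re (K p p)"
    using psd_kernel_form[OF assms(1)] by metis
  then show ?thesis using im that by blast
qed

lemma psd_kernel_zero_row:
  assumes "psd_kernel I K" "finite I" "p \<in> I" "K p p = 0" "q \<in> I"
  shows "K p q = 0"
proof (rule ccontr)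
  assume nz: "K p q \<noteq> 0"
  have herm: "\<And>i j. i \<in> I \<Longrightarrow> j \<in> I \<Longrightarrow> K j i = cnj (K i j)"
    by (rule psd_kernel_herm[OF assms(1)])
  define x :: "'a \<Rightarrow> complex" where "x = (\<lambda>i. if i = q then 1 else 0)"
  define c where "c = (cmod (K p q))\<^sup>2"
  have cpos: "c > 0" using nz by (simp add: c_def)
  have Kx: "(\<Sum>j\<in>I. K p j * x j) = K p q"
    using assms(2,5) by (simp add: x_def if_distrib if_distribR cong: if_cong)
  \<comment> \<open>Moving the coordinate at \<open>p\<close> changes the form linearly because \<open>K p p = 0\<close>; this step length
    makes its value \<open>- 1\<close>.\<close>
  define s where "s = (Re (hform I K x) + 1) / (2 * c)"
  have kk: "K p q * cnj (K p q) = of_real c" "cnj (K p q) * K p q = of_real c"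
    unfolding c_def using complex_norm_square by (metis, metis mult.commute)
  have "hform I K (\<lambda>i. x i + (if i = p then - (of_real s * K p q) else 0)) =
     hform I K x - of_real s * (cnj (K p q) * K p q) - of_real s * (K p q * cnj (K p q))"
    using hform_shift[OF assms(1-3), where x = x and t = "- (of_real s * K p q)"]
    by (simp add: Kx assms(4))
  then have "Re (hform I K (\<lambda>i. x i + (if i = p then - (of_real s * K p q) else 0))) =
     Re (hform I K x) - 2 * s * c"
    by (simp add: kk)
  also have "\<dots> = -1" using cpos by (simp add: s_def field_simps)
  finally show False using psd_kernel_form[OF assms(1)] by (metis neg_0_le_iff_le not_one_le_zero)
qed

text \<open>A Schur complement: subtracting a rank-one kernel clears the row and the column of a chosen
  index and leaves a positive semidefinite kernel, because for each \<open>x\<close> the remaining form is the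
  minimum of the original form over all changes of the coordinate \<open>x p\<close>.\<close>

lemma psd_kernel_split_rank_one:
  assumes "psd_kernel I K" "finite I" "p \<in> I"
  obtains \<zeta> where "psd_kernel I (\<lambda>i j. K i j - \<zeta> i * cnj (\<zeta> j))"
    and "\<And>i. i \<in> I \<Longrightarrow> K p i = \<zeta> p * cnj (\<zeta> i)" and "\<And>i. i \<in> I \<Longrightarrow> K i p = \<zeta> i * cnj (\<zeta> p)"
proof -
  have herm: "\<And>i j. i \<in> I \<Longrightarrow> j \<in> I \<Longrightarrow> K j i = cnj (K i j)"
    by (rule psd_kernel_herm[OF assms(1)])
  obtain d where d: "d \<ge> 0" "K p p = complex_of_real d"
    using psd_kernel_diag[OF assms] .
  show thesis
  proof (cases "d = 0")
    case True
    then have "K p i = 0" if "i \<in> I" for i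
      using psd_kernel_zero_row[OF assms] d that by simp
    moreover from this have "K i p = 0" if "i \<in> I" for i
      using herm assms(3) that by (metis complex_cnj_zero)
    ultimately show thesis using that[of "\<lambda>i. 0"] assms(1) by simp
  next
    case False
    then have dpos: "d > 0" using d by simp
    define \<zeta> where "\<zeta> = (\<lambda>i. K i p / of_real (sqrt d))"
    have ss: "complex_of_real (sqrt d) * complex_of_real (sqrt d) = of_real d"
      using dpos by (simp flip: of_real_mult)
    have zz: "\<zeta> i * cnj (\<zeta> j) = K i p * K p j / of_real d" if "i \<in> I" "j \<in> I" for i j
      using herm[of j p] that assms(3) ss by (simp add: \<zeta>_def)
    show thesis
    proof (rule that[of \<zeta>])
      show "psd_kernel I (\<lambda>i j. K i j - \<zeta> i * cnj (\<zeta> j))"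
      proof (rule psd_kernelI)
        fix x
        define b where "b = (\<Sum>j\<in>I. K p j * x j)"
        have bz: "(\<Sum>i\<in>I. cnj (\<zeta> i) * x i) = b / of_real (sqrt d)"
          unfolding b_def sum_divide_distrib
        proof (intro sum.cong refl)
          fix i assume "i \<in> I"
          then show "cnj (\<zeta> i) * x i = K p i * x i / of_real (sqrt d)"
            using herm[of i p] assms(3) by (simp add: \<zeta>_def)
        qed
        have bb: "b * cnj b = of_real ((cmod b)\<^sup>2)"
          using complex_norm_square by simp
        \<comment> \<open>\<open>- b / d\<close> is the change of \<open>x p\<close> that minimises the form of \<open>K\<close>.\<close>
        have "hform I (\<lambda>i j. K i j - \<zeta> i * cnj (\<zeta> j)) x =
              hform I K x - hform I (\<lambda>i j. \<zeta> i * cnj (\<zeta> j)) x"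
          by (simp add: hform_def algebra_simps sum_subtractf)
        also have "\<dots> = hform I K x - of_real ((cmod b)\<^sup>2 / d)"
          unfolding hform_rank_one bz using dpos
          by (simp add: norm_divide power_divide)
        also have "\<dots> = hform I K x + cnj (- (b / of_real d)) * b + (- (b / of_real d)) * cnj b
            + of_real d * (- (b / of_real d)) * cnj (- (b / of_real d))"
          using dpos bb by (simp add: field_simps)
        also have "\<dots> = hform I K (\<lambda>i. x i + (if i = p then - (b / of_real d) else 0))"
          using hform_shift[OF assms, where x = x and t = "- (b / of_real d)"]
          by (simp only: b_def d(2))
        finally show "0 \<le> Re (hform I (\<lambda>i j. K i j - \<zeta> i * cnj (\<zeta> j)) x)"
          using psd_kernel_form[OF assms(1)] by simp
      qed (simp, metis herm)
    qed (use zz d dpos assms(3) in auto)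
  qed
qed

text \<open>The Schur product theorem, by induction on the index set: a rank-one factor acts as a diagonal
  congruence, and what is left after splitting it off lives on a smaller index set.\<close>

lemma psd_kernel_schur_product:
  assumes "finite I" "psd_kernel I K" "psd_kernel I L"
  shows "psd_kernel I (\<lambda>i j. K i j * L i j)"
  using assms
proof (induction I arbitrary: K L rule: finite_induct)
  case empty
  then show ?case by (simp add: psd_kernel_def hform_def)
next
  case (insert p I)
  let ?I = "insert p I"
  obtain \<zeta> where \<zeta>: "psd_kernel ?I (\<lambda>i j. L i j - \<zeta> i * cnj (\<zeta> j))"
    "\<And>i. i \<in> ?I \<Longrightarrow> L p i = \<zeta> p * cnj (\<zeta> i)" "\<And>i. i \<in> ?I \<Longrightarrow> L i p = \<zeta> i * cnj (\<zeta> p)"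
    using psd_kernel_split_rank_one[OF insert.prems(2), of p] insert.hyps by blast
  define R where "R = (\<lambda>i j. if i = p \<or> j = p then 0 else L i j - \<zeta> i * cnj (\<zeta> j))"
  have "psd_kernel I (\<lambda>i j. L i j - \<zeta> i * cnj (\<zeta> j))"
    using psd_kernel_subset[OF \<zeta>(1)] insert.hyps by blast
  then have "psd_kernel I R"
    by (rule psd_kernel_cong) (use insert.hyps in \<open>auto simp: R_def\<close>)
  moreover have "psd_kernel I K"
    using psd_kernel_subset[OF insert.prems(1)] insert.hyps by blast
  ultimately have "psd_kernel I (\<lambda>i j. K i j * R i j)"
    using insert.IH by blast
  then have "psd_kernel ?I (\<lambda>i j. K i j * R i j)"
    using insert.hyps by (intro psd_kernel_insert_zero) (auto simp: R_def)
  from psd_kernel_add[OF psd_kernel_diag_congruence[OF insert.prems(1), of \<zeta>] this]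
  show ?case
    by (rule psd_kernel_cong) (use \<zeta> in \<open>auto simp: R_def algebra_simps\<close>)
qed

lemma psd_kernel_power:
  assumes "finite I" "psd_kernel I K"
  shows "psd_kernel I (\<lambda>i j. K i j ^ m)"
  by (induction m) (auto simp: psd_kernel_one intro!: psd_kernel_schur_product assms)

lemma psd_kernel_reindex:
  fixes I :: "'a set"
  assumes "bij_betw g J I" "psd_kernel I K"
  shows "psd_kernel J (\<lambda>i j. K (g i) (g j))"
proof (rule psd_kernelI)
  fix x
  define y :: "'a \<Rightarrow> complex" where "y = (\<lambda>i. x (inv_into J g i))"
  have inj: "inj_on g J" and img: "g ` J = I" using assms(1) by (auto simp: bij_betw_def)
  have "hform I K y = hform J (\<lambda>i j. K (g i) (g j)) x"
    unfolding hform_def img[symmetric] by (simp add: sum.reindex inj y_def)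
  then show "0 \<le> Re (hform J (\<lambda>i j. K (g i) (g j)) x)"
    using psd_kernel_form[OF assms(2)] by metis
next
  fix i j assume "i \<in> J" "j \<in> J"
  then show "K (g j) (g i) = cnj (K (g i) (g j))"
    using assms by (intro psd_kernel_herm[of I]) (auto simp: bij_betw_def)
qed

section \<open>Matrices as kernels\<close>

lemma psd_cmats_iff:
  "A \<in> psd_cmats n \<longleftrightarrow> A \<in> carrier_mat n n \<and> psd_kernel {..<n} (\<lambda>i j. A $$ (i, j))"
proof (cases "A \<in> carrier_mat n n")
  case True
  have herm: "hermitian_mat A \<longleftrightarrow> (\<forall>i\<in>{..<n}. \<forall>j\<in>{..<n}. A $$ (j, i) = cnj (A $$ (i, j)))"
    (is "_ \<longleftrightarrow> ?H")
  proof -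
    have adj: "mat_adjoint A \<in> carrier_mat n n" "\<And>i j. i < n \<Longrightarrow> j < n \<Longrightarrow> mat_adjoint A $$ (i, j) = cnj (A $$ (j, i))"
      using True by (auto simp: mat_adjoint_def mat_of_rows_def)
    show ?thesis
    proof
      assume "hermitian_mat A"
      then have "mat_adjoint A = A" by (simp add: hermitian_mat_def)
      then show ?H using adj(2) by (metis complex_cnj_cnj lessThan_iff)
    next
      assume ?H
      then show "hermitian_mat A"
        unfolding hermitian_mat_def
      proof (intro eq_matI)
        fix i j assume "i < dim_row A" "j < dim_col A"
        then have ij: "i < n" "j < n" using True by auto
        then have "A $$ (i, j) = cnj (A $$ (j, i))" using \<open>?H\<close> by blast
        then show "mat_adjoint A $$ (i, j) = A $$ (i, j)" using adj ij by simp
      qed (use adj(1) True in simp_all)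
    qed
  qed
  have form: "(A *\<^sub>v v) \<bullet>c v = hform {..<n} (\<lambda>i j. A $$ (i, j)) (vec_index v)"
    if "v \<in> carrier_vec n" for v
  proof -
    have "(A *\<^sub>v v) \<bullet>c v = (\<Sum>i<n. (\<Sum>j<n. A $$ (i, j) * vec_index v j) * cnj (vec_index v i))"
      using True that unfolding scalar_prod_def
      by (intro sum.cong) (simp_all add: scalar_prod_def atLeast0LessThan)
    then show ?thesis
      by (simp add: hform_def sum_distrib_right)
  qed
  have "(\<forall>v\<in>carrier_vec n. 0 \<le> Re ((A *\<^sub>v v) \<bullet>c v)) \<longleftrightarrow>
        (\<forall>x. 0 \<le> Re (hform {..<n} (\<lambda>i j. A $$ (i, j)) x))" (is "?L \<longleftrightarrow> ?R")
  proof
    assume ?L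
    show ?R
    proof
      fix x
      have "hform {..<n} (\<lambda>i j. A $$ (i, j)) (vec_index (Matrix.vec n x)) = hform {..<n} (\<lambda>i j. A $$ (i, j)) x"
        unfolding hform_def by (intro sum.cong) auto
      then show "0 \<le> Re (hform {..<n} (\<lambda>i j. A $$ (i, j)) x)"
        using \<open>?L\<close> form[of "Matrix.vec n x"] by (metis vec_carrier)
    qed
  qed (use form in auto)
  with herm True show ?thesis by (simp add: psd_cmats_def psd_kernel_def)
qed (auto simp: psd_cmats_def)

lemma preserves_psd_iff:
  "preserves_psd f n \<longleftrightarrow>
     (\<forall>K. psd_kernel {..<n} K \<longrightarrow> psd_kernel {..<n} (\<lambda>i j. f (K i j)))" (is "?L \<longleftrightarrow> ?R")
proof
  assume L: ?L
  show ?R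
  proof (intro allI impI)
    fix K assume K: "psd_kernel {..<n} K"
    have "Matrix.mat n n (\<lambda>(i, j). K i j) \<in> psd_cmats n"
      unfolding psd_cmats_iff by (intro conjI psd_kernel_cong[OF K]) simp_all
    then have "psd_kernel {..<n} (\<lambda>i j. map_mat f (Matrix.mat n n (\<lambda>(i, j). K i j)) $$ (i, j))"
      using L[unfolded preserves_psd_def, rule_format] psd_cmats_iff by metis
    then show "psd_kernel {..<n} (\<lambda>i j. f (K i j))"
      by (rule psd_kernel_cong) simp
  qed
next
  assume R: ?R
  show ?L
    unfolding preserves_psd_def
  proof
    fix A assume A: "A \<in> psd_cmats n"
    then have "psd_kernel {..<n} (\<lambda>i j. f (A $$ (i, j)))"
      using R psd_cmats_iff by metis
    then show "map_mat f A \<in> psd_cmats n"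
      using A unfolding psd_cmats_iff by (intro conjI) (auto elim!: psd_kernel_cong)
  qed
qed

text \<open>Since \<open>f 0 = 0\<close>, padding with zeros carries preservation on \<open>n\<close>-by-\<open>n\<close> matrices down to every
  index set with at most \<open>n\<close> elements, so counterexamples may be built on whatever set is
  convenient.\<close>

lemma preserves_psd_kernel:
  assumes pres: "preserves_psd f n" and f0: "f 0 = 0"
    and I: "finite I" "card I \<le> n" and K: "psd_kernel I K"
  shows "psd_kernel I (\<lambda>i j. f (K i j))"
proof -
  obtain g where g: "bij_betw g {..<card I} I"
    using ex_bij_betw_nat_finite[OF I(1)] by (auto simp: lessThan_atLeast0)
  define L where "L = (\<lambda>i j. if i < card I \<and> j < card I then K (g i) (g j) else 0)"
  have "psd_kernel {..<card I} (\<lambda>i j. K (g i) (g j))"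
    by (rule psd_kernel_reindex[OF g K])
  then have L1: "psd_kernel {..<card I} L"
    by (rule psd_kernel_cong) (auto simp: L_def)
  have "psd_kernel {..<n} L"
  proof (rule psd_kernelI)
    fix x
    have "hform {..<n} L x = hform {..<card I} L x"
      using I by (intro hform_subset) (auto simp: L_def)
    then show "0 \<le> Re (hform {..<n} L x)" using psd_kernel_form[OF L1] by simp
  next
    fix i j
    show "L j i = cnj (L i j)"
      using psd_kernel_herm[OF L1, of i j] by (cases "i < card I \<and> j < card I") (auto simp: L_def)
  qed
  then have "psd_kernel {..<n} (\<lambda>i j. f (L i j))"
    using pres by (auto simp: preserves_psd_iff)
  then have "psd_kernel {..<card I} (\<lambda>i j. f (L i j))"
    by (rule psd_kernel_subset) (use I in auto)
  from psd_kernel_reindex[OF bij_betw_inv_into[OF g] this]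
  show ?thesis
  proof (rule psd_kernel_cong)
    fix i j assume ij: "i \<in> I" "j \<in> I"
    have "inv_into {..<card I} g k < card I" if "k \<in> I" for k
      using bij_betw_inv_into[OF g] that by (auto simp: bij_betw_def)
    moreover have "g (inv_into {..<card I} g k) = k" if "k \<in> I" for k
      using g that by (simp add: bij_betw_inv_into_right)
    ultimately show "f (K i j) = f (L (inv_into {..<card I} g i) (inv_into {..<card I} g j))"
      using ij by (simp add: L_def)
  qed
qed

section \<open>The power functions with integral angular exponent\<close>

lemma Psi_eq_sgn: "Psi \<alpha> (of_int b) z = of_real (cmod z powr \<alpha>) * sgn z powi b"
proof (cases "z = 0")
  case False
  then show ?thesis
    by (simp add: Psi_def rcis_def cis_Arg[symmetric] cis_power_int)
qed simp

lemma Psi_mult: "Psi \<alpha> (of_int b) (z * w) = Psi \<alpha> (of_int b) z * Psi \<alpha> (of_int b) w"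
  by (simp add: Psi_eq_sgn norm_mult powr_mult sgn_mult power_int_mult_distrib)

lemma sgn_cnj: "sgn (cnj z) = cnj (sgn z)"
  by (simp add: sgn_eq)

lemma Psi_cnj: "Psi \<alpha> (of_int b) (cnj z) = cnj (Psi \<alpha> (of_int b) z)"
  by (simp add: Psi_eq_sgn sgn_cnj)

lemma Psi_uminus: "Psi \<alpha> (- \<beta>) z = cnj (Psi \<alpha> \<beta> z)"
  by (simp add: Psi_def rcis_def cis_cnj)

lemma norm_Psi: "cmod (Psi \<alpha> \<beta> z) = cmod z powr \<alpha>"
  by (simp add: Psi_def)

lemma Psi_nonneg_real: "r \<ge> 0 \<Longrightarrow> Psi \<alpha> \<beta> (of_real r) = of_real (r powr \<alpha>)"
  by (auto simp: Psi_def rcis_def)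

lemma Psi_neg_real: "r < 0 \<Longrightarrow> Psi \<alpha> (of_int b) (of_real r) = of_real (\<bar>r\<bar> powr \<alpha> * (- 1) powi b)"
  by (simp add: Psi_eq_sgn sgn_of_real)

lemma Psi_eq_powi:
  assumes "z \<noteq> 0"
  shows "Psi \<alpha> (of_int b) z = of_real (cmod z powr (\<alpha> - of_int b)) * z powi b"
proof -
  have "z = of_real (cmod z) * sgn z"
    using assms by (simp add: sgn_eq)
  then have "z powi b = of_real (cmod z) powi b * sgn z powi b"
    by (metis power_int_mult_distrib)
  also have "of_real (cmod z) powi b = complex_of_real (cmod z powr of_int b)"
    using assms by (simp add: powr_real_of_int' flip: of_real_power_int)
  finally show ?thesis
    using assms by (simp add: Psi_eq_sgn powr_diff)
qed

text \<open>The condition excludes only the exponent pair \<open>(0, 0)\<close>, for which the two sides differ at the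
  origin.\<close>

lemma Psi_monomial:
  assumes "real k + 2 * real j > 0"
  shows "Psi (real k + 2 * real j) (real k) z = z ^ (k + j) * cnj z ^ j"
proof (cases "z = 0")
  case True
  then show ?thesis using assms by (cases "k + j = 0") (auto simp: power_0_left)
next
  case False
  have "cmod z powr (2 * real j) = cmod z powr real (2 * j)" by simp
  also have "\<dots> = ((cmod z)\<^sup>2) ^ j"
    using False by (subst powr_realpow) (simp_all add: power_mult)
  finally have "cmod z powr (2 * real j) = ((cmod z)\<^sup>2) ^ j" .
  then have "complex_of_real (cmod z powr (2 * real j)) = (z * cnj z) ^ j"
    unfolding of_real_power[of "(cmod z)\<^sup>2" j, symmetric] complex_norm_square[symmetric] by (rule arg_cong)
  then show ?thesis
    using Psi_eq_powi[OF False, of "real k + 2 * real j" "int k"]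
    by (simp add: power_add power_mult_distrib)
qed

text \<open>Along a real line \<open>Psi\<close> has the derivative that
  \<open>z powr ((\<alpha> + b) / 2) * cnj z powr ((\<alpha> - b) / 2)\<close> suggests when \<open>z\<close> and \<open>cnj z\<close> are treated as
  independent variables; the condition \<open>\<alpha> > 1\<close> covers the passage through the origin.\<close>

lemma Psi_has_vector_derivative:
  assumes "\<alpha> > 1"
  shows "((\<lambda>t. Psi \<alpha> (of_int b) (w + of_real t * c)) has_vector_derivative
      (of_real ((\<alpha> + of_int b) / 2) * Psi (\<alpha> - 1) (of_int (b - 1)) (w + of_real t * c) * c +
       of_real ((\<alpha> - of_int b) / 2) * Psi (\<alpha> - 1) (of_int (b + 1)) (w + of_real t * c) * cnj c)) (at t)"
proof (cases "w + of_real t * c = 0")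
  case True
  then have w: "w = - of_real t * c" by (simp add: add_eq_0_iff)
  have n: "cmod (Psi \<alpha> (of_int b) (w + of_real y * c)) / \<bar>y - t\<bar> = \<bar>y - t\<bar> powr (\<alpha> - 1) * cmod c powr \<alpha>" for y
  proof (cases "y = t")
    case True then show ?thesis using assms w by simp
  next
    case False
    have "w + of_real y * c = of_real (y - t) * c" by (simp add: w algebra_simps)
    then have "cmod (w + of_real y * c) = \<bar>y - t\<bar> * cmod c"
      by (simp only: norm_mult norm_of_real)
    then show ?thesis
      using False by (simp add: norm_Psi powr_mult powr_diff)
  qed
  have "((\<lambda>y. \<bar>y - t\<bar> powr (\<alpha> - 1) * cmod c powr \<alpha>) \<longlongrightarrow> \<bar>t - t\<bar> powr (\<alpha> - 1) * cmod c powr \<alpha>) (at t)"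
    using assms by (intro tendsto_intros tendsto_powr') auto
  then have "((\<lambda>y. \<bar>y - t\<bar> powr (\<alpha> - 1) * cmod c powr \<alpha>) \<longlongrightarrow> 0) (at t)"
    using assms by simp
  then have "((\<lambda>y. cmod (Psi \<alpha> (of_int b) (w + of_real y * c)) / \<bar>y - t\<bar>) \<longlongrightarrow> 0) (at t)"
    by (simp only: n)
  then have "((\<lambda>t. Psi \<alpha> (of_int b) (w + of_real t * c)) has_vector_derivative 0) (at t)"
    unfolding has_vector_derivative_def has_derivative_iff_norm using True by simp
  then show ?thesis using True by simp
next
  case False
  define z where "z = (\<lambda>t. w + of_real t * c)"
  have z0: "z t \<noteq> 0" using False by (simp add: z_def)
  have dz: "(z has_vector_derivative c) (at s)" for s
    unfolding z_def by (auto intro!: derivative_eq_intros)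
  \<comment> \<open>Away from the origin \<open>Psi\<close> is \<open>(cmod z)\<^sup>2 powr \<gamma> * z powi b\<close>: a power of a smooth positive
    real function times a holomorphic one, with no branch cut.\<close>
  define \<gamma> where "\<gamma> = (\<alpha> - of_int b) / 2"
  define q where "q = (\<lambda>t. (Re (z t))\<^sup>2 + (Im (z t))\<^sup>2)"
  have q: "q s = (cmod (z s))\<^sup>2" for s by (simp add: q_def cmod_power2)
  have qpos: "q t > 0" using z0 by (simp add: q)
  have dq: "(q has_real_derivative 2 * Re (cnj (z t) * c)) (at t)"
    unfolding q_def by (auto intro!: derivative_eq_intros dz simp: algebra_simps)
  have dp: "((\<lambda>s. q s powr \<gamma>) has_real_derivative (\<gamma> * q t powr (\<gamma> - 1)) * (2 * Re (cnj (z t) * c))) (at t)"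
    by (rule DERIV_chain2[OF has_real_derivative_powr[OF qpos] dq])
  have dpow: "((\<lambda>u. u powi b) has_field_derivative of_int b * z t powi (b - 1)) (at (z t))"
    using z0 by (auto intro!: derivative_eq_intros)
  have dz': "((\<lambda>s. z s powi b) has_vector_derivative c * (of_int b * z t powi (b - 1))) (at t)"
    using field_vector_diff_chain_at[OF dz dpow] by (simp add: o_def)
  have main: "((\<lambda>s. of_real (q s powr \<gamma>) * z s powi b) has_vector_derivative
      (of_real (q t powr \<gamma>) * (c * (of_int b * z t powi (b - 1))) +
       of_real ((\<gamma> * q t powr (\<gamma> - 1)) * (2 * Re (cnj (z t) * c))) * z t powi b)) (at t)"
    by (rule has_vector_derivative_mult[OF has_vector_derivative_of_real[OF dp] dz'])
  have qp: "q s powr \<delta> = cmod (z s) powr (2 * \<delta>)" if "z s \<noteq> 0" for s \<delta>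
    using that by (simp add: q powr_powr flip: powr_numeral)
  have zz: "z t powi b = z t powi (b - 1) * z t" "z t powi (b + 1) = z t powi (b - 1) * z t * z t"
    using z0 by (simp_all add: power_int_diff power_int_add field_simps)
  have nn: "complex_of_real (cmod (z t) powr (2 * \<gamma>)) =
      of_real (cmod (z t) powr (2 * (\<gamma> - 1))) * (z t * cnj (z t))"
  proof -
    have "cmod (z t) powr (2 * \<gamma>) = cmod (z t) powr (2 * (\<gamma> - 1)) * (cmod (z t))\<^sup>2"
      using z0 by (simp flip: powr_numeral powr_add)
    then show ?thesis by (simp only: of_real_mult complex_norm_square)
  qed
  have g2: "2 * \<gamma> = \<alpha> - of_int b" and g3: "2 * (\<gamma> - 1) = \<alpha> - 1 - of_int (b + 1)"
    by (simp_all add: \<gamma>_def)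
  have P1: "Psi (\<alpha> - 1) (of_int (b - 1)) (z t) = of_real (cmod (z t) powr (2 * \<gamma>)) * z t powi (b - 1)"
    using Psi_eq_powi[OF z0, of "\<alpha> - 1" "b - 1"] g2 by simp
  have P2: "Psi (\<alpha> - 1) (of_int (b + 1)) (z t) = of_real (cmod (z t) powr (2 * (\<gamma> - 1))) * z t powi (b + 1)"
    using Psi_eq_powi[OF z0, of "\<alpha> - 1" "b + 1"] g3 by simp
  have R2: "complex_of_real (2 * Re (cnj (z t) * c)) = cnj (z t) * c + z t * cnj c"
    using complex_add_cnj[of "cnj (z t) * c"] by simp
  have ab: "complex_of_real ((\<alpha> + of_int b) / 2) = of_real \<gamma> + of_int b"
    by (simp add: \<gamma>_def field_simps)
  have val: "of_real (q t powr \<gamma>) * (c * (of_int b * z t powi (b - 1))) +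
       of_real ((\<gamma> * q t powr (\<gamma> - 1)) * (2 * Re (cnj (z t) * c))) * z t powi b =
      of_real ((\<alpha> + of_int b) / 2) * Psi (\<alpha> - 1) (of_int (b - 1)) (z t) * c +
       of_real ((\<alpha> - of_int b) / 2) * Psi (\<alpha> - 1) (of_int (b + 1)) (z t) * cnj c"
    unfolding P1 P2 qp[OF z0] of_real_mult[of "\<gamma> * _"] R2 ab nn zz \<gamma>_def[symmetric]
    by (simp add: algebra_simps)
  have "\<forall>\<^sub>F s in at t. z s \<noteq> 0"
  proof -
    have "isCont z t" using dz has_vector_derivative_continuous by blast
    then show ?thesis using z0
      by (metis isCont_def tendsto_imp_eventually_ne)
  qed
  then have "\<forall>\<^sub>F s in nhds t. z s \<noteq> 0"
    using z0 by (simp add: eventually_nhds_conv_at)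
  then have "\<forall>\<^sub>F s in nhds t. of_real (q s powr \<gamma>) * z s powi b = Psi \<alpha> (of_int b) (z s)"
    by eventually_elim (simp add: Psi_eq_powi qp g2)
  then have "((\<lambda>s. Psi \<alpha> (of_int b) (z s)) has_vector_derivative
      (of_real (q t powr \<gamma>) * (c * (of_int b * z t powi (b - 1))) +
       of_real ((\<gamma> * q t powr (\<gamma> - 1)) * (2 * Re (cnj (z t) * c))) * z t powi b)) (at t)"
    using main by (subst (asm) has_vector_derivative_cong_ev[where g = "\<lambda>s. Psi \<alpha> (of_int b) (z s)"])
      (auto dest: eventually_nhds_x_imp_x elim: eventually_mono)
  then show ?thesis unfolding val by (simp add: z_def)
qed

section \<open>Powers that preserve positivity\<close>

text \<open>\<open>Psi\<close> is multiplicative and commutes with conjugation.\<close>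

lemma psd_kernel_Psi_rank_one: "psd_kernel I (\<lambda>i j. Psi \<alpha> (of_int b) (\<zeta> i * cnj (\<zeta> j)))"
  by (simp add: Psi_mult Psi_cnj psd_kernel_rank_one)

text \<open>After splitting off a rank-one kernel at most one diagonal entry remains, and it can only have
  grown, so monotonicity of the real power suffices.\<close>

lemma Psi_psd_kernel_card_le_2:
  assumes "finite I" "card I \<le> 2" "psd_kernel I K" "\<alpha> \<ge> 0"
  shows "psd_kernel I (\<lambda>i j. Psi \<alpha> (of_int b) (K i j))"
proof (cases "I = {}")
  case True then show ?thesis by (simp add: psd_kernel_def hform_def)
next
  case False
  then obtain p where p: "p \<in> I" by blast
  define J where "J = I - {p}"
  have IJ: "I = insert p J" and fJ: "finite J" using p assms(1) by (auto simp: J_def)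
  obtain \<zeta> where \<zeta>: "psd_kernel I (\<lambda>i j. K i j - \<zeta> i * cnj (\<zeta> j))"
    "\<And>i. i \<in> I \<Longrightarrow> K p i = \<zeta> p * cnj (\<zeta> i)" "\<And>i. i \<in> I \<Longrightarrow> K i p = \<zeta> i * cnj (\<zeta> p)"
    using psd_kernel_split_rank_one[OF assms(3,1) p] by blast
  define R where "R = (\<lambda>i j. if i = p \<or> j = p then 0 else
     Psi \<alpha> (of_int b) (K i j) - Psi \<alpha> (of_int b) (\<zeta> i * cnj (\<zeta> j)))"
  have "psd_kernel J R"
  proof (cases "J = {}")
    case True then show ?thesis by (simp add: psd_kernel_def hform_def)
  next
    case False
    have "card J \<le> 1" using assms(1,2) p by (simp add: J_def)
    then obtain q where q: "J = {q}"
      using False fJ by (metis card_0_eq card_1_singletonE le_neq_implies_less less_one)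
    have qI: "q \<in> I" "q \<noteq> p" using q by (auto simp: J_def)
    obtain d where d: "d \<ge> 0" "K q q - \<zeta> q * cnj (\<zeta> q) = complex_of_real d"
      using psd_kernel_diag[OF \<zeta>(1) assms(1) qI(1)] by blast
    define e where "e = (cmod (\<zeta> q))\<^sup>2"
    have e: "e \<ge> 0" "\<zeta> q * cnj (\<zeta> q) = complex_of_real e"
      unfolding e_def using complex_norm_square by auto
    have "K q q = complex_of_real (e + d)" using d e by (simp add: algebra_simps)
    then have "R q q = of_real ((e + d) powr \<alpha> - e powr \<alpha>)"
      using Psi_nonneg_real[of e] Psi_nonneg_real[of "e + d"] d e qI by (simp add: R_def del: of_real_add)
    moreover have "e powr \<alpha> \<le> (e + d) powr \<alpha>"
      using d e assms(4) by (intro powr_mono2) auto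
    ultimately obtain r where "r \<ge> 0" "R q q = of_real r" by (metis diff_ge_0_iff_ge)
    then show ?thesis
      unfolding q by (intro psd_kernel_cong[OF psd_kernel_scale[OF _ psd_kernel_one]]) auto
  qed
  then have "psd_kernel I R"
    unfolding IJ by (intro psd_kernel_insert_zero) (use fJ in \<open>auto simp: R_def\<close>)
  from psd_kernel_add[OF psd_kernel_Psi_rank_one[of I \<alpha> b \<zeta>] this]
  show ?thesis
    by (rule psd_kernel_cong) (use \<zeta> in \<open>auto simp: R_def\<close>)
qed

text \<open>The FitzGerald--Horn induction step.  Split \<open>K\<close> into a rank-one kernel and a remainder supported
  on one index fewer, and move along the segment from the former to \<open>K\<close>.  By the derivative formula
  and the Schur product theorem, the quadratic form of the entrywise image is nondecreasing.\<close>

lemma Psi_psd_kernel_step: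
  fixes I :: "'a set"
  assumes I: "finite I" "card I \<le> Suc m" and K: "psd_kernel I K"
    and \<alpha>: "\<alpha> > 1" "\<bar>of_int b\<bar> \<le> \<alpha>"
    and low: "\<And>(J :: 'a set) L. finite J \<Longrightarrow> card J \<le> m \<Longrightarrow> psd_kernel J L \<Longrightarrow>
        psd_kernel J (\<lambda>i j. Psi (\<alpha> - 1) (of_int (b - 1)) (L i j))"
    and up: "\<And>(J :: 'a set) L. finite J \<Longrightarrow> card J \<le> m \<Longrightarrow> psd_kernel J L \<Longrightarrow>
        psd_kernel J (\<lambda>i j. Psi (\<alpha> - 1) (of_int (b + 1)) (L i j))"
  shows "psd_kernel I (\<lambda>i j. Psi \<alpha> (of_int b) (K i j))"
proof (cases "I = {}")
  case True then show ?thesis by (simp add: psd_kernel_def hform_def)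
next
  case False
  then obtain p where p: "p \<in> I" by blast
  define J where "J = I - {p}"
  have IJ: "I = insert p J" and fJ: "finite J" "J \<subseteq> I" using p I(1) by (auto simp: J_def)
  have cJ: "card J \<le> m" using I p by (simp add: J_def)
  obtain \<zeta> where \<zeta>: "psd_kernel I (\<lambda>i j. K i j - \<zeta> i * cnj (\<zeta> j))"
    "\<And>i. i \<in> I \<Longrightarrow> K p i = \<zeta> p * cnj (\<zeta> i)" "\<And>i. i \<in> I \<Longrightarrow> K i p = \<zeta> i * cnj (\<zeta> p)"
    using psd_kernel_split_rank_one[OF K I(1) p] by blast
  define C where "C = (\<lambda>i j. if i = p \<or> j = p then 0 else K i j - \<zeta> i * cnj (\<zeta> j))"
  have CI: "psd_kernel I C"
    using \<zeta>(1) by (rule psd_kernel_cong) (use \<zeta> in \<open>auto simp: C_def\<close>)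
  have CJ: "psd_kernel J C" using psd_kernel_subset[OF CI I(1) fJ(2)] .
  define M where "M = (\<lambda>t i j. \<zeta> i * cnj (\<zeta> j) + complex_of_real t * C i j)"
  have MJ: "psd_kernel J (M t)" if "t \<ge> 0" for t
    unfolding M_def by (intro psd_kernel_add psd_kernel_rank_one psd_kernel_scale that CJ)
  have M1: "M 1 i j = K i j" if "i \<in> I" "j \<in> I" for i j
    using \<zeta> that by (auto simp: M_def C_def)
  define E where "E = (\<lambda>t i j.
      of_real ((\<alpha> + of_int b) / 2) * (Psi (\<alpha> - 1) (of_int (b - 1)) (M t i j) * C i j) +
      of_real ((\<alpha> - of_int b) / 2) * (Psi (\<alpha> - 1) (of_int (b + 1)) (M t i j) * cnj (C i j)))"
  have E: "psd_kernel I (E t)" if "t \<ge> 0" for t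
  proof -
    have "psd_kernel J (E t)"
      unfolding E_def using \<alpha>
      by (intro psd_kernel_add psd_kernel_scale psd_kernel_schur_product psd_kernel_cnj low up MJ CJ fJ cJ that)
        auto
    then show ?thesis
      unfolding IJ by (intro psd_kernel_insert_zero) (use fJ in \<open>auto simp: E_def C_def\<close>)
  qed
  have "Psi \<alpha> (of_int b) (K j i) = cnj (Psi \<alpha> (of_int b) (K i j))" if "i \<in> I" "j \<in> I" for i j
    using psd_kernel_herm[OF K that] by (simp add: Psi_cnj)
  moreover have "0 \<le> Re (hform I (\<lambda>i j. Psi \<alpha> (of_int b) (K i j)) x)" for x
  proof -
    define g where "g = (\<lambda>t. Re (hform I (\<lambda>i j. Psi \<alpha> (of_int b) (M t i j)) x))"
    have "((\<lambda>t. hform I (\<lambda>i j. Psi \<alpha> (of_int b) (M t i j)) x) has_vector_derivative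
        hform I (E t) x) (at t)" for t
      unfolding hform_def
    proof (intro has_vector_derivative_sum)
      fix i j
      have "((\<lambda>t. Psi \<alpha> (of_int b) (M t i j)) has_vector_derivative E t i j) (at t)"
        using Psi_has_vector_derivative[OF \<alpha>(1), of b "\<zeta> i * cnj (\<zeta> j)" "C i j" t]
        by (simp add: M_def E_def mult.assoc)
      then show "((\<lambda>t. Psi \<alpha> (of_int b) (M t i j) * x j * cnj (x i)) has_vector_derivative
          E t i j * x j * cnj (x i)) (at t)"
        by (intro has_vector_derivative_mult_left)
    qed
    then have "DERIV g t :> Re (hform I (E t) x)" for t
      unfolding g_def by (rule has_field_derivative_Re)
    then have deriv: "\<exists>y. DERIV g t :> y \<and> y \<ge> 0" if "0 \<le> t" for t
      using psd_kernel_form[OF E[OF that], of x] by blast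
    have "g 0 \<le> g 1"
      by (rule DERIV_nonneg_imp_nondecreasing[OF zero_le_one deriv])
    moreover have "0 \<le> g 0"
      unfolding g_def M_def using psd_kernel_form[OF psd_kernel_Psi_rank_one[of I \<alpha> b \<zeta>], of x]
      by simp
    moreover have "hform I (\<lambda>i j. Psi \<alpha> (of_int b) (M 1 i j)) x = hform I (\<lambda>i j. Psi \<alpha> (of_int b) (K i j)) x"
      by (intro hform_cong) (simp add: M1)
    ultimately show ?thesis by (simp add: g_def)
  qed
  ultimately show ?thesis by (rule psd_kernelI)
qed

text \<open>The induction step needs \<open>\<alpha> > 1\<close>; the value \<open>\<alpha> = 1\<close>, which can occur only for three-by-three
  matrices, is a limit of larger exponents.\<close>

lemma Psi_psd_kernel_limit:
  assumes "\<And>\<gamma>. \<gamma> > \<alpha> \<Longrightarrow> psd_kernel I (\<lambda>i j. Psi \<gamma> (of_int b) (K i j))"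
    and K: "psd_kernel I K"
  shows "psd_kernel I (\<lambda>i j. Psi \<alpha> (of_int b) (K i j))"
proof (rule psd_kernelI)
  fix i j assume "i \<in> I" "j \<in> I"
  from psd_kernel_herm[OF K this]
  show "Psi \<alpha> (of_int b) (K j i) = cnj (Psi \<alpha> (of_int b) (K i j))"
    by (simp add: Psi_cnj)
next
  fix x
  have P: "((\<lambda>\<gamma>. Psi \<gamma> (of_int b) z) \<longlongrightarrow> Psi \<alpha> (of_int b) z) (at_right \<alpha>)" for z
    unfolding Psi_eq_sgn by (cases "z = 0") (auto intro!: tendsto_intros)
  have "((\<lambda>\<gamma>. Re (hform I (\<lambda>i j. Psi \<gamma> (of_int b) (K i j)) x)) \<longlongrightarrow>
      Re (hform I (\<lambda>i j. Psi \<alpha> (of_int b) (K i j)) x)) (at_right \<alpha>)"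
    unfolding hform_def by (intro tendsto_intros P)
  moreover have "\<forall>\<^sub>F \<gamma> in at_right \<alpha>. 0 \<le> Re (hform I (\<lambda>i j. Psi \<gamma> (of_int b) (K i j)) x)"
    by (rule eventually_mono[OF eventually_at_right_less]) (rule psd_kernel_form[OF assms(1)])
  ultimately show "0 \<le> Re (hform I (\<lambda>i j. Psi \<alpha> (of_int b) (K i j)) x)"
    by (intro tendsto_lowerbound) auto
qed

text \<open>Both bounds survive the step from \<open>(m, \<alpha>, b)\<close> to \<open>(m - 1, \<alpha> - 1, b \<plusminus> 1)\<close>, the second one
  because the loss of two on its right-hand side pays for both the drop of \<open>\<alpha>\<close> and the growth
  of \<open>\<bar>b\<bar>\<close>.\<close>

lemma Psi_psd_kernel_large_power:
  fixes I :: "'a set"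
  assumes "finite I" "card I \<le> m + 3" "psd_kernel I K"
    and "\<alpha> \<ge> real m + 1" "\<alpha> \<ge> \<bar>of_int b\<bar> + 2 * real m"
  shows "psd_kernel I (\<lambda>i j. Psi \<alpha> (of_int b) (K i j))"
  using assms
proof (induction m arbitrary: I K \<alpha> b)
  case 0
  have gt: "psd_kernel I (\<lambda>i j. Psi \<gamma> (of_int b) (K i j))" if "\<gamma> > \<alpha>" for \<gamma>
  proof (rule Psi_psd_kernel_step[where m = 2])
    fix J :: "'a set" and L
    assume J: "finite J" "card J \<le> 2" "psd_kernel J L"
    have \<gamma>: "\<gamma> - 1 \<ge> 0" using 0 that by simp
    show "psd_kernel J (\<lambda>i j. Psi (\<gamma> - 1) (of_int (b - 1)) (L i j))"
      by (rule Psi_psd_kernel_card_le_2[OF J \<gamma>])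
    show "psd_kernel J (\<lambda>i j. Psi (\<gamma> - 1) (of_int (b + 1)) (L i j))"
      by (rule Psi_psd_kernel_card_le_2[OF J \<gamma>])
  qed (use 0 that in auto)
  show ?case by (rule Psi_psd_kernel_limit[OF gt "0.prems"(3)])
next
  case (Suc m)
  show ?case
  proof (rule Psi_psd_kernel_step[where m = "m + 3"])
    fix J :: "'a set" and L
    assume J: "finite J" "card J \<le> m + 3" "psd_kernel J L"
    show "psd_kernel J (\<lambda>i j. Psi (\<alpha> - 1) (of_int (b - 1)) (L i j))"
      by (rule Suc.IH[OF J]) (use Suc.prems(4,5) in auto)
    show "psd_kernel J (\<lambda>i j. Psi (\<alpha> - 1) (of_int (b + 1)) (L i j))"
      by (rule Suc.IH[OF J]) (use Suc.prems(4,5) in auto)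
  qed (use Suc.prems in auto)
qed

lemma Psi_psd_kernel_monomial:
  assumes "finite I" "psd_kernel I K" "\<bar>of_int b\<bar> + 2 * real j > 0"
  shows "psd_kernel I (\<lambda>s t. Psi (\<bar>of_int b\<bar> + 2 * real j) (of_int b) (K s t))"
proof -
  define k where "k = nat \<bar>b\<bar>"
  have k: "\<bar>of_int b\<bar> = real k" by (simp add: k_def)
  have *: "psd_kernel I (\<lambda>s t. Psi (real k + 2 * real j) (real k) (K s t))"
    using assms unfolding Psi_monomial[OF assms(3)[unfolded k]]
    by (intro psd_kernel_schur_product psd_kernel_power psd_kernel_cnj) auto
  show ?thesis
  proof (cases "b \<ge> 0")
    case True
    then have "of_int b = real k" by (simp add: k_def)
    then show ?thesis using * k by simp
  next
    case False
    then have "of_int b = - real k" by (simp add: k_def)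
    then show ?thesis using psd_kernel_cnj[OF *] k by (simp add: Psi_uminus)
  qed
qed

lemma preserves_psd_Psi:
  assumes n: "n \<ge> 3" and \<beta>: "\<beta> \<in> \<int>" "(\<alpha>, \<beta>) \<noteq> (0, 0)"
    and \<alpha>: "\<alpha> \<in> {\<bar>\<beta>\<bar> - 2 + 2 * real k | k. k \<ge> 1} \<or>
         \<alpha> \<ge> max (real n - 2) (\<bar>\<beta>\<bar> + 2 * real n - 6)"
  shows "preserves_psd (Psi \<alpha> \<beta>) n"
  unfolding preserves_psd_iff
proof (intro allI impI)
  fix K assume K: "psd_kernel {..<n} K"
  obtain b where b: "\<beta> = of_int b" using \<beta>(1) by (auto elim: Ints_cases)
  from \<alpha> show "psd_kernel {..<n} (\<lambda>i j. Psi \<alpha> \<beta> (K i j))"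
  proof
    assume "\<alpha> \<in> {\<bar>\<beta>\<bar> - 2 + 2 * real k | k. k \<ge> 1}"
    then obtain k where k: "k \<ge> 1" "\<alpha> = \<bar>\<beta>\<bar> - 2 + 2 * real k" by blast
    then have "\<alpha> = \<bar>of_int b\<bar> + 2 * real (k - 1)" by (simp add: b of_nat_diff)
    then show ?thesis
      using Psi_psd_kernel_monomial[OF _ K, of b "k - 1"] \<beta>(2) b by auto
  next
    assume "\<alpha> \<ge> max (real n - 2) (\<bar>\<beta>\<bar> + 2 * real n - 6)"
    then show ?thesis
      unfolding b using n K by (intro Psi_psd_kernel_large_power[where m = "n - 3"]) (auto simp: b)
  qed
qed

section \<open>Alternating binomial sums\<close>

text \<open>Pascal's rule turns the functional of order \<open>m + 1\<close> into that of order \<open>m\<close> applied to minus the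
  forward difference, which lowers degrees by one.\<close>

lemma alternating_binomial_sum_Suc:
  fixes P :: "nat \<Rightarrow> 'a::comm_ring_1"
  shows "(\<Sum>s\<le>Suc m. (-1) ^ s * of_nat (Suc m choose s) * P s) =
    (\<Sum>s\<le>m. (-1) ^ s * of_nat (m choose s) * P s) - (\<Sum>s\<le>m. (-1) ^ s * of_nat (m choose s) * P (Suc s))"
proof -
  have "(\<Sum>s\<le>m. (-1) ^ s * of_nat (m choose s) * P s) =
        (\<Sum>s\<le>Suc m. (-1) ^ s * of_nat (m choose s) * P s)" by (simp add: binomial_eq_0)
  also have "\<dots> = P 0 + (\<Sum>s\<le>m. (-1) ^ Suc s * of_nat (m choose Suc s) * P (Suc s))"
    by (subst sum.atMost_Suc_shift) simp
  finally have 1: "(\<Sum>s\<le>m. (-1) ^ s * of_nat (m choose s) * P s) =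
     P 0 + (\<Sum>s\<le>m. (-1) ^ Suc s * of_nat (m choose Suc s) * P (Suc s))" .
  show ?thesis
    unfolding 1 by (subst sum.atMost_Suc_shift) (simp add: algebra_simps sum.distrib sum_negf sum_subtractf)
qed

lemma alternating_binomial_sum_power:
  "l < m \<Longrightarrow> (\<Sum>s\<le>m. (-1) ^ s * of_nat (m choose s) * of_nat s ^ l) = (0 :: 'a::{idom, ring_char_0})"
  "(\<Sum>s\<le>m. (-1) ^ s * of_nat (m choose s) * of_nat s ^ m) = ((-1) ^ m * fact m :: 'a::{idom, ring_char_0})"
proof (induction m arbitrary: l)
  case (Suc m)
  have rec: "(\<Sum>s\<le>Suc m. (-1) ^ s * of_nat (Suc m choose s) * of_nat s ^ l) =
      - (\<Sum>q<l. of_nat (l choose q) * (\<Sum>s\<le>m. (-1) ^ s * of_nat (m choose s) * of_nat s ^ q :: 'a))" for l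
  proof -
    have "of_nat s ^ l - of_nat (Suc s) ^ l = - (\<Sum>q<l. of_nat (l choose q) * (of_nat s ^ q :: 'a))" for s
    proof -
      have "of_nat (Suc s) ^ l = (of_nat s + 1 :: 'a) ^ l" by (simp add: add.commute)
      also have "\<dots> = (\<Sum>q\<le>l. of_nat (l choose q) * of_nat s ^ q)"
        by (subst binomial_ring) simp
      finally show ?thesis by (simp add: lessThan_Suc_atMost[symmetric])
    qed
    then have "(\<Sum>s\<le>m. (-1) ^ s * of_nat (m choose s) * (of_nat s ^ l - of_nat (Suc s) ^ l)) =
      - (\<Sum>s\<le>m. \<Sum>q<l. of_nat (l choose q) * ((-1) ^ s * of_nat (m choose s) * of_nat s ^ q :: 'a))"
      by (simp add: sum_distrib_left sum_negf mult_ac)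
    also have "\<dots> = - (\<Sum>q<l. of_nat (l choose q) * (\<Sum>s\<le>m. (-1) ^ s * of_nat (m choose s) * of_nat s ^ q :: 'a))"
      by (subst sum.swap) (simp add: sum_distrib_left)
    finally show ?thesis
      unfolding alternating_binomial_sum_Suc by (simp add: sum_subtractf[symmetric] algebra_simps)
  qed
  {
    case 1
    then show ?case unfolding rec using Suc.IH(1) by simp
  next
    case 2
    show ?case unfolding rec using Suc.IH by simp
  }
qed simp_all

lemma alternating_binomial_sum_poly:
  fixes p :: "'a::{idom, ring_char_0} poly"
  assumes "degree p < m"
  shows "(\<Sum>s\<le>m. (-1) ^ s * of_nat (m choose s) * poly p (of_nat s)) = 0"
proof -
  have "(\<Sum>s\<le>m. (-1) ^ s * of_nat (m choose s) * poly p (of_nat s)) =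
      (\<Sum>i\<le>degree p. coeff p i * (\<Sum>s\<le>m. (-1) ^ s * of_nat (m choose s) * of_nat s ^ i))"
    unfolding poly_altdef sum_distrib_left by (subst sum.swap) (simp add: mult_ac)
  also have "\<dots> = 0"
    using assms by (intro sum.neutral) (simp add: alternating_binomial_sum_power(1))
  finally show ?thesis .
qed

section \<open>A discrete Cauchy--Riemann operator\<close>

text \<open>With the forward differences \<open>\<Delta>\<^sub>x P z = P (z + 1) - P z\<close> and
  \<open>\<Delta>\<^sub>y P z = P (z + \<i>) - P z\<close>, this is the value at the origin of the \<open>m\<close>-th iterate of
  \<open>\<Delta>\<^sub>x + \<i> * \<Delta>\<^sub>y\<close> applied to \<open>P\<close>, a discrete form of twice the derivative with respect
  to \<open>cnj z\<close>.\<close>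

primrec dbar_diff :: "nat \<Rightarrow> (complex \<Rightarrow> complex) \<Rightarrow> complex" where
  "dbar_diff 0 P = P 0"
| "dbar_diff (Suc m) P =
     dbar_diff m (\<lambda>z. P (z + 1)) + \<i> * dbar_diff m (\<lambda>z. P (z + \<i>)) - (1 + \<i>) * dbar_diff m P"

definition lattice_triangle :: "nat \<Rightarrow> complex set" where
  "lattice_triangle m = (\<lambda>(p, q). of_nat p + \<i> * of_nat q) ` {(p, q). p + q \<le> m}"

lemma finite_triangle_index: "finite {(p, q). p + q \<le> (m :: nat)}"
  by (rule finite_subset[of _ "{..m} \<times> {..m}"]) auto

lemma finite_triangle: "finite (lattice_triangle m)"
  unfolding lattice_triangle_def by (intro finite_imageI finite_triangle_index)

lemma card_triangle: "2 * card (lattice_triangle m) \<le> (m + 1) * (m + 2)"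
proof -
  have "{(p, q). p + q \<le> m} = Sigma {..m} (\<lambda>p. {..m - p})" by auto
  then have "card {(p, q). p + q \<le> m} = (\<Sum>p\<le>m. Suc (m - p))"
    by (simp add: card_SigmaI)
  also have "2 * \<dots> = (m + 1) * (m + 2)"
    by (induction m) (simp_all add: sum.atMost_Suc_shift del: sum.atMost_Suc)
  finally show ?thesis
    using card_image_le[OF finite_triangle_index[of m]] unfolding lattice_triangle_def
    by (metis mult_le_mono2)
qed

lemma triangle_Suc:
  "lattice_triangle m \<subseteq> lattice_triangle (Suc m)" "(\<lambda>z. z + 1) ` lattice_triangle m \<subseteq> lattice_triangle (Suc m)"
  "(\<lambda>z. z + \<i>) ` lattice_triangle m \<subseteq> lattice_triangle (Suc m)"
proof -
  have I: "of_nat p + \<i> * of_nat q \<in> lattice_triangle k" if "p + q \<le> k" for p q k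
    using that by (auto simp: lattice_triangle_def)
  show "lattice_triangle m \<subseteq> lattice_triangle (Suc m)" by (auto simp: lattice_triangle_def)
  show "(\<lambda>z. z + 1) ` lattice_triangle m \<subseteq> lattice_triangle (Suc m)"
  proof
    fix y assume "y \<in> (\<lambda>z. z + 1) ` lattice_triangle m"
    then obtain p q where "p + q \<le> m" "y = of_nat (Suc p) + \<i> * of_nat q"
      by (auto simp: lattice_triangle_def algebra_simps)
    then show "y \<in> lattice_triangle (Suc m)" using I[of "Suc p" q "Suc m"] by simp
  qed
  show "(\<lambda>z. z + \<i>) ` lattice_triangle m \<subseteq> lattice_triangle (Suc m)"
  proof
    fix y assume "y \<in> (\<lambda>z. z + \<i>) ` lattice_triangle m"
    then obtain p q where "p + q \<le> m" "y = of_nat p + \<i> * of_nat (Suc q)"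
      by (auto simp: lattice_triangle_def algebra_simps)
    then show "y \<in> lattice_triangle (Suc m)" using I[of p "Suc q" "Suc m"] by simp
  qed
qed

text \<open>Each further difference reaches one unit to the right or upwards, so only the lattice triangle
  is sampled.  Its size is the number of monomials in \<open>z\<close> and \<open>cnj z\<close> of degree at most \<open>m\<close>, so no
  smaller set could separate them.\<close>

lemma dbar_diff_weights: "\<exists>v. \<forall>P. dbar_diff m P = (\<Sum>s\<in>lattice_triangle m. v s * P s)"
proof (induction m)
  case 0
  have "lattice_triangle 0 = {0}" by (auto simp: lattice_triangle_def)
  then show ?case by (intro exI[of _ "\<lambda>s. 1"]) simp
next
  case (Suc m)
  then obtain v where v: "\<And>P. dbar_diff m P = (\<Sum>s\<in>lattice_triangle m. v s * P s)" by blast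
  define ext where "ext = (\<lambda>h z. if z - h \<in> lattice_triangle m then v (z - h) else 0)"
  have shift: "dbar_diff m (\<lambda>z. P (z + h)) = (\<Sum>s\<in>lattice_triangle (Suc m). ext h s * P s)"
    if sub: "(\<lambda>z. z + h) ` lattice_triangle m \<subseteq> lattice_triangle (Suc m)" for h P
  proof -
    have "(\<Sum>s\<in>lattice_triangle (Suc m). ext h s * P s) = (\<Sum>s\<in>(\<lambda>z. z + h) ` lattice_triangle m. ext h s * P s)"
    proof (rule sum.mono_neutral_right[OF finite_triangle sub], rule ballI)
      fix y assume "y \<in> lattice_triangle (Suc m) - (\<lambda>z. z + h) ` lattice_triangle m"
      then have "y - h \<notin> lattice_triangle m" by (metis DiffD2 diff_add_cancel imageI)
      then show "ext h y * P y = 0" by (simp add: ext_def)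
    qed
    also have "\<dots> = (\<Sum>s\<in>lattice_triangle m. v s * P (s + h))"
      by (subst sum.reindex) (auto simp: ext_def inj_on_def)
    finally show ?thesis by (simp add: v)
  qed
  have "dbar_diff (Suc m) P = (\<Sum>s\<in>lattice_triangle (Suc m). (ext 1 s + \<i> * ext \<i> s - (1 + \<i>) * ext 0 s) * P s)" for P
    using shift[OF triangle_Suc(2)] shift[OF triangle_Suc(3)] shift[of 0 P] triangle_Suc(1)
    by (simp add: algebra_simps sum.distrib sum_subtractf sum_distrib_left)
  then show ?case by (intro exI[of _ "\<lambda>s. ext 1 s + \<i> * ext \<i> s - (1 + \<i>) * ext 0 s"]) blast
qed

lemma dbar_diff_sum: "dbar_diff m (\<lambda>z. \<Sum>x\<in>X. c x * P x z) = (\<Sum>x\<in>X. c x * dbar_diff m (P x))"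
proof -
  obtain v where v: "\<And>P. dbar_diff m P = (\<Sum>s\<in>lattice_triangle m. v s * P s)"
    using dbar_diff_weights by blast
  show ?thesis
    unfolding v sum_distrib_left by (subst sum.swap) (simp add: mult_ac)
qed

text \<open>The value at the origin of the first-order operator \<open>\<Delta>\<^sub>x + \<i> * \<Delta>\<^sub>y\<close> on
  \<open>z ^ r * cnj z ^ s\<close>.  It is \<open>0\<close> on constants and on \<open>z\<close>, and \<open>2\<close> on \<open>cnj z\<close>.\<close>

definition dbar_moment :: "nat \<Rightarrow> nat \<Rightarrow> complex" where
  "dbar_moment r s = 1 + \<i> * (\<i> ^ r * (- \<i>) ^ s) - (if r = 0 \<and> s = 0 then 1 + \<i> else 0)"

lemma dbar_diff_monomial_Suc:
  "dbar_diff (Suc m) (\<lambda>z. z ^ j * cnj z ^ k) =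
     (\<Sum>(p, q)\<in>{..j} \<times> {..k}. of_nat (j choose p) * of_nat (k choose q) * dbar_moment (j - p) (k - q) *
        dbar_diff m (\<lambda>z. z ^ p * cnj z ^ q))"
proof -
  let ?M = "\<lambda>p q. dbar_diff m (\<lambda>z. z ^ p * cnj z ^ q)"
  have shift: "dbar_diff m (\<lambda>z. (z + h) ^ j * cnj (z + h) ^ k) =
      (\<Sum>(p, q)\<in>{..j} \<times> {..k}. of_nat (j choose p) * of_nat (k choose q) * (h ^ (j - p) * cnj h ^ (k - q)) * ?M p q)" for h
  proof -
    have "(z + h) ^ j * cnj (z + h) ^ k = (\<Sum>x\<in>{..j} \<times> {..k}.
        (of_nat (j choose fst x) * of_nat (k choose snd x) * (h ^ (j - fst x) * cnj h ^ (k - snd x))) *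
        (z ^ fst x * cnj z ^ snd x))" for z
      by (simp add: binomial_ring sum_product sum.cartesian_product case_prod_unfold mult_ac)
    then show ?thesis by (simp add: dbar_diff_sum case_prod_unfold)
  qed
  have top: "?M j k = (\<Sum>(p, q)\<in>{..j} \<times> {..k}. of_nat (j choose p) * of_nat (k choose q) *
      (if j - p = 0 \<and> k - q = 0 then 1 else 0) * ?M p q)"
  proof -
    have "(\<Sum>(p, q)\<in>{..j} \<times> {..k}. of_nat (j choose p) * of_nat (k choose q) *
      (if j - p = 0 \<and> k - q = 0 then 1 else 0) * ?M p q) =
      (\<Sum>x\<in>{..j} \<times> {..k}. if x = (j, k) then ?M j k else 0)"
      by (intro sum.cong) (auto split: if_splits)
    then show ?thesis by simp
  qed
  have "dbar_diff (Suc m) (\<lambda>z. z ^ j * cnj z ^ k) =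
      dbar_diff m (\<lambda>z. (z + 1) ^ j * cnj (z + 1) ^ k) + \<i> * dbar_diff m (\<lambda>z. (z + \<i>) ^ j * cnj (z + \<i>) ^ k)
      - (1 + \<i>) * ?M j k" by simp
  also have "\<dots> = (\<Sum>(p, q)\<in>{..j} \<times> {..k}. of_nat (j choose p) * of_nat (k choose q) * dbar_moment (j - p) (k - q) *
        ?M p q)"
    unfolding shift sum_distrib_left sum.distrib[symmetric]
    by (subst top, unfold sum_distrib_left sum_subtractf[symmetric], intro sum.cong refl)
      (auto simp: dbar_moment_def algebra_simps)
  finally show ?thesis .
qed

text \<open>Every term of the recursion has a lower-order factor that vanishes by induction or a moment that
  vanishes: one step kills constants, and it cannot lower the degree in \<open>z\<close> alone by one.\<close>

lemma dbar_diff_monomial_eq_0: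
  "j + k \<le> m \<Longrightarrow> (j, k) \<noteq> (0, m) \<Longrightarrow> dbar_diff m (\<lambda>z. z ^ j * cnj z ^ k) = 0"
proof (induction m arbitrary: j k)
  case (Suc m)
  show ?case
    unfolding dbar_diff_monomial_Suc
  proof (rule sum.neutral, rule ballI)
    fix x assume "x \<in> {..j} \<times> {..k}"
    then obtain p q where x: "x = (p, q)" and pq: "p \<in> {..j}" "q \<in> {..k}" by blast
    have "of_nat (j choose p) * of_nat (k choose q) * dbar_moment (j - p) (k - q) *
        dbar_diff m (\<lambda>z. z ^ p * cnj z ^ q) = 0"
    proof (cases "p + q \<le> m \<and> (p, q) \<noteq> (0, m)")
      case True
      then show ?thesis using Suc.IH by simp
    next
      case False
      then have "k = q \<and> (j = p \<or> j = Suc p)"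
        using pq Suc.prems by auto
      then have "dbar_moment (j - p) (k - q) = 0" by (auto simp: dbar_moment_def)
      then show ?thesis by simp
    qed
    then show "(case x of (p, q) \<Rightarrow> of_nat (j choose p) * of_nat (k choose q) * dbar_moment (j - p) (k - q) *
        dbar_diff m (\<lambda>z. z ^ p * cnj z ^ q)) = 0"
      by (simp add: x)
  qed
qed simp

lemma dbar_diff_cnj_power: "dbar_diff m (\<lambda>z. cnj z ^ m) = 2 ^ m * fact m"
proof (induction m)
  case (Suc m)
  have "dbar_diff (Suc m) (\<lambda>z. cnj z ^ Suc m) = dbar_diff (Suc m) (\<lambda>z. z ^ 0 * cnj z ^ Suc m)" by simp
  also have "\<dots> = (\<Sum>(p, q)\<in>{..0} \<times> {..Suc m}. of_nat (0 choose p) * of_nat (Suc m choose q) *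
      dbar_moment (0 - p) (Suc m - q) * dbar_diff m (\<lambda>z. z ^ p * cnj z ^ q))"
    by (rule dbar_diff_monomial_Suc)
  also have "\<dots> = (\<Sum>q\<le>Suc m. of_nat (Suc m choose q) * dbar_moment 0 (Suc m - q) *
      dbar_diff m (\<lambda>z. z ^ 0 * cnj z ^ q))"
    by (simp add: sum.cartesian_product[symmetric] del: sum.atMost_Suc)
  also have "\<dots> = (\<Sum>q\<le>Suc m. if q = m then of_nat (Suc m) * 2 * (2 ^ m * fact m) else 0)"
  proof (intro sum.cong refl)
    fix q assume "q \<in> {..Suc m}"
    then consider "q < m" | "q = m" | "q = Suc m" by force
    then show "of_nat (Suc m choose q) * dbar_moment 0 (Suc m - q) * dbar_diff m (\<lambda>z. z ^ 0 * cnj z ^ q) =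
        (if q = m then of_nat (Suc m) * 2 * (2 ^ m * fact m) else 0)"
    proof cases
      case 1
      then show ?thesis using dbar_diff_monomial_eq_0[of 0 q m] by simp
    next
      case 2
      then show ?thesis using Suc.IH by (simp add: dbar_moment_def)
    next
      case 3
      then show ?thesis by (simp add: dbar_moment_def)
    qed
  qed
  also have "\<dots> = 2 ^ Suc m * fact (Suc m)" by simp
  finally show ?case .
qed simp

lemma triangle_isolates_cnj_power:
  obtains v where "\<And>j k. j + k \<le> m \<Longrightarrow> (j, k) \<noteq> (0, m) \<Longrightarrow> (\<Sum>s\<in>lattice_triangle m. v s * s ^ j * cnj s ^ k) = 0"
    and "(\<Sum>s\<in>lattice_triangle m. v s * cnj s ^ m) \<noteq> 0"
proof -
  obtain v where v: "\<And>P. dbar_diff m P = (\<Sum>s\<in>lattice_triangle m. v s * P s)"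
    using dbar_diff_weights by blast
  show thesis
    using that[of v] dbar_diff_monomial_eq_0[of _ _ m] dbar_diff_cnj_power[of m]
    by (simp add: v mult.assoc)
qed

section \<open>Expansion at the all-ones matrix\<close>

lemma of_real_gbinomial: "(of_real x gchoose k) = complex_of_real (x gchoose k)"
  by (simp add: gbinomial_prod_rev)

text \<open>Conjugating the second factor from outside gives it the argument of \<open>cnj z\<close> without a branch
  problem, so the formula holds even on the negative real axis and for nonintegral \<open>\<beta>\<close>.\<close>

lemma Psi_eq_powr_mult_cnj:
  assumes "z \<noteq> 0"
  shows "Psi \<alpha> \<beta> z = z powr of_real ((\<alpha> + \<beta>) / 2) * cnj (z powr of_real ((\<alpha> - \<beta>) / 2))"
proof -
  have Ln: "Ln z = of_real (ln (cmod z)) + \<i> * of_real (Arg z)"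
    using assms by (simp add: complex_eq_iff Arg_eq_Im_Ln)
  have "z powr of_real ((\<alpha> + \<beta>) / 2) * cnj (z powr of_real ((\<alpha> - \<beta>) / 2)) =
      exp (of_real ((\<alpha> + \<beta>) / 2) * Ln z + of_real ((\<alpha> - \<beta>) / 2) * cnj (Ln z))"
    using assms by (simp add: powr_def exp_cnj exp_add)
  also have "of_real ((\<alpha> + \<beta>) / 2) * Ln z + of_real ((\<alpha> - \<beta>) / 2) * cnj (Ln z) =
      of_real (\<alpha> * ln (cmod z)) + \<i> * of_real (\<beta> * Arg z)"
    unfolding Ln by (simp add: algebra_simps add_divide_distrib diff_divide_distrib)
  also have "exp \<dots> = of_real (cmod z powr \<alpha>) * cis (\<beta> * Arg z)"
    using assms by (simp add: exp_add cis_conv_exp powr_def exp_of_real[symmetric])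
  finally show ?thesis
    using assms by (simp add: Psi_def rcis_def)
qed

lemma Psi_series:
  assumes "cmod w < 1"
  shows "(\<lambda>l. \<Sum>j\<le>l. of_real (((\<alpha> + \<beta>) / 2 gchoose j) * ((\<alpha> - \<beta>) / 2 gchoose (l - j))) *
      (w ^ j * cnj w ^ (l - j))) sums Psi \<alpha> \<beta> (1 + w)"
proof -
  define a b where "a = (\<alpha> + \<beta>) / 2" and "b = (\<alpha> - \<beta>) / 2"
  have sm: "summable (\<lambda>n. norm ((of_real c gchoose n) * w ^ n))" for c :: real
  proof -
    obtain r where r: "cmod w < r" "r < 1" using assms dense by blast
    then have "0 < r" using norm_ge_zero[of w] by linarith
    then have "(\<lambda>n. (of_real c gchoose n) * (of_real r :: complex) ^ n) sums (1 + of_real r) powr of_real c"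
      using r by (intro gen_binomial_complex) simp
    then show ?thesis
      using r \<open>0 < r\<close> by (intro powser_insidea[of _ "of_real r"]) (auto simp: sums_iff)
  qed
  have A: "(\<lambda>n. (of_real a gchoose n) * w ^ n) sums (1 + w) powr of_real a"
    using gen_binomial_complex[OF assms] by blast
  have B: "(\<lambda>n. cnj ((of_real b gchoose n) * w ^ n)) sums cnj ((1 + w) powr of_real b)"
    using gen_binomial_complex[OF assms] by (simp only: sums_cnj)
  have sB: "summable (\<lambda>n. norm (cnj ((of_real b gchoose n) * w ^ n)))"
    using sm[of b] by (simp only: complex_mod_cnj)
  have "1 + w \<noteq> 0" using assms by (metis add_eq_0_iff norm_minus_cancel norm_one order_less_irrefl)
  then have "Psi \<alpha> \<beta> (1 + w) = (1 + w) powr of_real a * cnj ((1 + w) powr of_real b)"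
    unfolding a_def b_def by (rule Psi_eq_powr_mult_cnj)
  then have "(\<lambda>l. \<Sum>j\<le>l. (of_real a gchoose j) * w ^ j * cnj ((of_real b gchoose (l - j)) * w ^ (l - j)))
      sums Psi \<alpha> \<beta> (1 + w)"
    using Cauchy_product_sums[OF sm[of a] sB] A B by (simp add: sums_iff)
  then show ?thesis
    by (simp add: a_def[symmetric] b_def[symmetric] of_real_gbinomial mult_ac)
qed

lemma power_series_first_coeff_nonneg:
  fixes d :: "nat \<Rightarrow> real"
  assumes "0 < r" and sums: "\<And>x. 0 < x \<Longrightarrow> x < r \<Longrightarrow> (\<lambda>l. d l * x ^ l) sums f x"
    and nonneg: "\<And>x. 0 < x \<Longrightarrow> x < r \<Longrightarrow> 0 \<le> f x" and zero: "\<And>l. l < K \<Longrightarrow> d l = 0"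
  shows "0 \<le> d K"
proof -
  have shifted: "(\<lambda>l. d (l + K) * x ^ l) sums (f x / x ^ K)" if "0 < x" "x < r" for x
  proof -
    have "(\<lambda>l. d (l + K) * x ^ (l + K)) sums (f x - (\<Sum>l<K. d l * x ^ l))"
      using sums[OF that] by (rule sums_split_initial_segment)
    then have "(\<lambda>l. d (l + K) * x ^ (l + K)) sums f x" by (simp add: zero)
    from sums_divide[OF this, of "x ^ K"] show ?thesis
      using that by (simp add: power_add)
  qed
  define F where "F = (\<lambda>x. \<Sum>l. d (l + K) * x ^ l)"
  have "isCont F 0"
    unfolding F_def using shifted[of "r / 2"] assms(1)
    by (intro isCont_powser[where K = "r / 2"]) (auto simp: sums_iff)
  then have "(F \<longlongrightarrow> F 0) (at_right 0)"
    by (simp add: isCont_def filterlim_at_split)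
  moreover have "\<forall>\<^sub>F x in at_right 0. 0 \<le> F x"
  proof -
    have "\<forall>\<^sub>F x in at_right 0. x \<in> {0<..<r}"
      using assms(1) eventually_at_right_real by blast
    then show ?thesis
    proof eventually_elim
      case (elim x)
      then have "F x = f x / x ^ K" unfolding F_def using shifted[of x] by (simp add: sums_iff)
      then show ?case using nonneg[of x] elim by simp
    qed
  qed
  ultimately have "0 \<le> F 0" by (intro tendsto_lowerbound) auto
  moreover have "F 0 = d K" unfolding F_def by simp
  ultimately show ?thesis by simp
qed

text \<open>The matrix with entries \<open>1 + x * u s * cnj (u t)\<close> is positive semidefinite for \<open>x \<ge> 0\<close>.  The
  binomial expansion of its image gives a power series in \<open>x\<close> for the quadratic form, in which each
  monomial contributes the squared modulus of a moment of \<open>v\<close>.\<close>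

lemma leading_coefficient_nonneg:
  fixes u v :: "'a \<Rightarrow> complex"
  assumes pres: "preserves_psd (Psi \<alpha> \<beta>) n" and S: "finite S" "card S \<le> n"
    and zero: "\<And>j k. j + k < m \<Longrightarrow> (\<Sum>s\<in>S. v s * u s ^ j * cnj (u s) ^ k) = 0"
  shows "0 \<le> (\<Sum>j\<le>m. ((\<alpha> + \<beta>) / 2 gchoose j) * ((\<alpha> - \<beta>) / 2 gchoose (m - j)) *
     (cmod (\<Sum>s\<in>S. v s * u s ^ j * cnj (u s) ^ (m - j)))\<^sup>2)"
proof -
  define c where "c = (\<lambda>j k. ((\<alpha> + \<beta>) / 2 gchoose j) * ((\<alpha> - \<beta>) / 2 gchoose k))"
  define \<mu> where "\<mu> = (\<lambda>j k. \<Sum>s\<in>S. v s * u s ^ j * cnj (u s) ^ k)"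
  define d where "d = (\<lambda>l. \<Sum>j\<le>l. c j (l - j) * (cmod (\<mu> j (l - j)))\<^sup>2)"
  define A where "A = (\<lambda>x::real. \<lambda>s t. 1 + of_real x * (u s * cnj (u t)))"
  define f where "f = (\<lambda>x. hform S (\<lambda>s t. Psi \<alpha> \<beta> (A x s t)) (\<lambda>s. cnj (v s)))"
  \<comment> \<open>A common bound on the points keeps all arguments of the series inside the unit disc for
    \<open>x < 1 / (B * B)\<close>.\<close>
  define B where "B = 1 + (\<Sum>s\<in>S. cmod (u s))"
  have B1: "B \<ge> 1" by (simp add: B_def sum_nonneg)
  have uB: "cmod (u s) \<le> B" if "s \<in> S" for s
    using member_le_sum[OF that _ S(1), of "\<lambda>s. cmod (u s)"] by (simp add: B_def)
  define r where "r = 1 / (B * B)"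
  have r: "r > 0" using B1 by (simp add: r_def)
  have sums: "(\<lambda>l. of_real (d l * x ^ l)) sums f x" if x: "0 < x" "x < r" for x
  proof -
    have "(\<lambda>l. (\<Sum>j\<le>l. of_real (c j (l - j)) *
        ((of_real x * (u s * cnj (u t))) ^ j * cnj (of_real x * (u s * cnj (u t))) ^ (l - j))) *
        cnj (v t) * cnj (cnj (v s))) sums (Psi \<alpha> \<beta> (A x s t) * cnj (v t) * cnj (cnj (v s)))"
      if "s \<in> S" "t \<in> S" for s t
    proof -
      have "cmod (of_real x * (u s * cnj (u t))) = x * (cmod (u s) * cmod (u t))"
        using x by (simp add: norm_mult)
      also have "\<dots> \<le> x * (B * B)"
        using uB that x B1 by (intro mult_left_mono mult_mono) auto
      also have "\<dots> < r * (B * B)" using x B1 by (intro mult_strict_right_mono) auto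
      finally have "cmod (of_real x * (u s * cnj (u t))) < 1" using B1 by (simp add: r_def)
      then show ?thesis
        unfolding A_def c_def by (intro sums_mult2 Psi_series)
    qed
    then have "(\<lambda>l. \<Sum>s\<in>S. \<Sum>t\<in>S. (\<Sum>j\<le>l. of_real (c j (l - j)) *
        ((of_real x * (u s * cnj (u t))) ^ j * cnj (of_real x * (u s * cnj (u t))) ^ (l - j))) *
        cnj (v t) * cnj (cnj (v s))) sums f x"
      unfolding f_def hform_def by (intro sums_sum)
    moreover have "(\<Sum>s\<in>S. \<Sum>t\<in>S. (\<Sum>j\<le>l. of_real (c j (l - j)) *
        ((of_real x * (u s * cnj (u t))) ^ j * cnj (of_real x * (u s * cnj (u t))) ^ (l - j))) *
        cnj (v t) * cnj (cnj (v s))) = of_real (d l * x ^ l)" for l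
    proof -
      have "(\<Sum>s\<in>S. \<Sum>t\<in>S. (\<Sum>j\<le>l. of_real (c j (l - j)) *
        ((of_real x * (u s * cnj (u t))) ^ j * cnj (of_real x * (u s * cnj (u t))) ^ (l - j))) *
        cnj (v t) * cnj (cnj (v s))) =
        (\<Sum>j\<le>l. \<Sum>s\<in>S. \<Sum>t\<in>S. of_real (c j (l - j)) *
        ((of_real x * (u s * cnj (u t))) ^ j * cnj (of_real x * (u s * cnj (u t))) ^ (l - j)) *
        cnj (v t) * v s)"
        unfolding sum_distrib_right complex_cnj_cnj
        by (rule trans[OF sum.cong[OF refl sum.swap] sum.swap])
      also have "\<dots> = (\<Sum>j\<le>l. of_real (c j (l - j) * x ^ l) * (\<mu> j (l - j) * cnj (\<mu> j (l - j))))"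
      proof (intro sum.cong refl)
        fix j assume "j \<in> {..l}"
        then have xl: "complex_of_real x ^ l = of_real x ^ j * of_real x ^ (l - j)"
          by (simp flip: power_add)
        show "(\<Sum>s\<in>S. \<Sum>t\<in>S. of_real (c j (l - j)) *
          ((of_real x * (u s * cnj (u t))) ^ j * cnj (of_real x * (u s * cnj (u t))) ^ (l - j)) *
          cnj (v t) * v s) = of_real (c j (l - j) * x ^ l) * (\<mu> j (l - j) * cnj (\<mu> j (l - j)))"
          unfolding \<mu>_def cnj_sum sum_product
          unfolding sum_distrib_left of_real_mult of_real_power xl
          by (intro sum.cong refl) (simp add: power_mult_distrib)
      qed
      also have "\<dots> = of_real (d l * x ^ l)"
        unfolding complex_norm_square[symmetric] of_real_mult[symmetric] of_real_sum[symmetric]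
          d_def sum_distrib_right by (simp only: mult_ac)
      finally show ?thesis .
    qed
    ultimately show ?thesis by simp
  qed
  have sumsR: "(\<lambda>l. d l * x ^ l) sums Re (f x)" if "0 < x" "x < r" for x
    using sums_Re[OF sums[OF that]] by (simp del: of_real_mult of_real_power)
  have nonneg: "0 \<le> Re (f x)" if "0 < x" "x < r" for x
  proof -
    have "psd_kernel S (A x)"
      unfolding A_def using that
      by (intro psd_kernel_add psd_kernel_one psd_kernel_scale psd_kernel_rank_one) simp
    then have "psd_kernel S (\<lambda>s t. Psi \<alpha> \<beta> (A x s t))"
      by (rule preserves_psd_kernel[OF pres Psi_0 S])
    then show ?thesis unfolding f_def by (rule psd_kernel_form)
  qed
  have "d l = 0" if "l < m" for l
    unfolding d_def \<mu>_def using that zero by simp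
  from power_series_first_coeff_nonneg[OF r sumsR nonneg this] have "0 \<le> d m" .
  then show ?thesis by (simp add: d_def c_def \<mu>_def)
qed

section \<open>Counterexamples\<close>

text \<open>Exactly one of the factors \<open>x - i\<close> with \<open>i \<le> N\<close> is negative.\<close>

lemma gbinomial_neg:
  fixes x :: real
  assumes "real N - 1 < x" "x < real N"
  shows "(x gchoose Suc N) < 0"
proof -
  have "(\<Prod>i=0..<N. x - real i) > 0"
    using assms by (intro prod_pos) auto
  then show ?thesis
    using assms by (simp add: gbinomial_prod_rev divide_less_0_iff mult_less_0_iff)
qed

lemma ex_negative_gbinomial:
  fixes x :: real
  assumes "x \<notin> \<nat>" "x < real m"
  obtains k where "k \<le> Suc m" "(x gchoose k) < 0"
proof (cases "x < 0")
  case True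
  then show thesis using that[of 1] by simp
next
  case False
  define N where "N = nat \<lceil>x\<rceil>"
  have N: "real N = of_int \<lceil>x\<rceil>" using False by (simp add: N_def)
  have "x \<noteq> real N" using assms(1) by (metis of_nat_in_Nats)
  then have "real N - 1 < x" "x < real N" using N ceiling_correct[of x] by linarith+
  moreover have "N \<le> m" using assms(2) by (simp add: N_def ceiling_le_iff nat_le_iff)
  ultimately show thesis using that[of "Suc N"] gbinomial_neg by simp
qed

text \<open>At order \<open>k\<close> the lattice weights leave only the monomial \<open>cnj z ^ k\<close>.\<close>

lemma preserves_psd_Psi_coefficient:
  assumes "preserves_psd (Psi \<alpha> \<beta>) n" "(k + 1) * (k + 2) \<le> 2 * n"
  shows "0 \<le> ((\<alpha> - \<beta>) / 2 gchoose k)"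
proof -
  obtain v where v: "\<And>i j. i + j \<le> k \<Longrightarrow> (i, j) \<noteq> (0, k) \<Longrightarrow> (\<Sum>s\<in>lattice_triangle k. v s * s ^ i * cnj s ^ j) = 0"
    and v0: "(\<Sum>s\<in>lattice_triangle k. v s * cnj s ^ k) \<noteq> 0"
    using triangle_isolates_cnj_power[of k] by blast
  have "card (lattice_triangle k) \<le> n" using card_triangle[of k] assms(2) by linarith
  from leading_coefficient_nonneg[OF assms(1) finite_triangle this, of k v "\<lambda>s. s"] v
  have "0 \<le> (\<Sum>j\<le>k. ((\<alpha> + \<beta>) / 2 gchoose j) * ((\<alpha> - \<beta>) / 2 gchoose (k - j)) *
     (cmod (\<Sum>s\<in>lattice_triangle k. v s * s ^ j * cnj s ^ (k - j)))\<^sup>2)" by simp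
  also have "\<dots> = (\<Sum>j\<le>k. if j = 0 then ((\<alpha> - \<beta>) / 2 gchoose k) * (cmod (\<Sum>s\<in>lattice_triangle k. v s * cnj s ^ k))\<^sup>2 else 0)"
    by (intro sum.cong) (auto simp: v)
  also have "\<dots> = ((\<alpha> - \<beta>) / 2 gchoose k) * (cmod (\<Sum>s\<in>lattice_triangle k. v s * cnj s ^ k))\<^sup>2" by simp
  finally show ?thesis using v0 by (simp add: zero_le_mult_iff)
qed

text \<open>On real points all monomials of degree \<open>k\<close> coincide, and Vandermonde's identity adds up their
  coefficients.\<close>

lemma preserves_psd_Psi_real_coefficient:
  assumes "preserves_psd (Psi \<alpha> \<beta>) n" "k < n"
  shows "0 \<le> (\<alpha> gchoose k)"
proof -
  define v :: "nat \<Rightarrow> complex" where "v = (\<lambda>s. (-1) ^ s * of_nat (k choose s))"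
  have v: "(\<Sum>s\<le>k. v s * of_nat s ^ l) = (if l = k then (-1) ^ k * fact k else 0)" if "l \<le> k" for l
    using that alternating_binomial_sum_power[where 'a = complex] by (auto simp: v_def)
  have "0 \<le> (\<Sum>j\<le>k. ((\<alpha> + \<beta>) / 2 gchoose j) * ((\<alpha> - \<beta>) / 2 gchoose (k - j)) *
     (cmod (\<Sum>s\<in>{..k}. v s * of_nat s ^ j * cnj (of_nat s) ^ (k - j)))\<^sup>2)"
    by (rule leading_coefficient_nonneg[OF assms(1)])
      (use assms(2) v in \<open>auto simp: mult.assoc power_add[symmetric]\<close>)
  also have "\<dots> = (\<Sum>j\<le>k. ((\<alpha> + \<beta>) / 2 gchoose j) * ((\<alpha> - \<beta>) / 2 gchoose (k - j)) *
     (cmod ((-1) ^ k * fact k))\<^sup>2)"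
    by (intro sum.cong refl) (simp add: mult.assoc power_add[symmetric] v)
  also have "\<dots> = (\<alpha> gchoose k) * (fact k)\<^sup>2"
    using gbinomial_Vandermonde[of "(\<alpha> + \<beta>) / 2" "(\<alpha> - \<beta>) / 2" k]
    by (simp add: sum_distrib_right[symmetric] norm_mult norm_power atLeast0AtMost add_divide_distrib[symmetric])
  finally show ?thesis by (simp add: zero_le_mult_iff)
qed

text \<open>A Hermitian image of the rank-one matrix with off-diagonal entries \<open>- 1\<close> requires
  \<open>cis (\<beta> * pi)\<close> to be real.\<close>

lemma preserves_psd_Psi_imp_Ints:
  assumes "preserves_psd (Psi \<alpha> \<beta>) n" "n \<ge> 2"
  shows "\<beta> \<in> \<int>"
proof -
  define \<zeta> :: "bool \<Rightarrow> complex" where "\<zeta> = (\<lambda>p. if p then 1 else - 1)"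
  have "psd_kernel UNIV (\<lambda>p q. Psi \<alpha> \<beta> (\<zeta> p * cnj (\<zeta> q)))"
    by (rule preserves_psd_kernel[OF assms(1) Psi_0 _ _ psd_kernel_rank_one]) (use assms(2) in auto)
  from psd_kernel_herm[OF this, of True False] have "Psi \<alpha> \<beta> (-1) = cnj (Psi \<alpha> \<beta> (-1))"
    by (simp add: \<zeta>_def)
  moreover have "Psi \<alpha> \<beta> (-1) = cis (\<beta> * pi)" by (simp add: Psi_def rcis_def Arg_eq_pi[THEN iffD2])
  ultimately have "sin (\<beta> * pi) = 0" by (simp add: complex_eq_iff)
  then show ?thesis by (auto simp: sin_zero_iff_int2)
qed

text \<open>The tridiagonal matrix with unit diagonal and off-diagonal entries \<open>c = 1 / sqrt 2\<close> is
  positive semidefinite and singular; any larger off-diagonal entries \<open>c powr \<alpha>\<close> make it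
  indefinite along its null vector \<open>(1, - sqrt 2, 1)\<close>.\<close>

lemma preserves_psd_Psi_imp_ge_1:
  assumes "preserves_psd (Psi \<alpha> \<beta>) n" "n \<ge> 3"
  shows "1 \<le> \<alpha>"
proof -
  define c where "c = 1 / sqrt 2"
  have c: "0 < c" "c < 1" "c * c = 1 / 2"
    by (simp_all add: c_def real_div_sqrt field_simps)
  define \<zeta> \<eta> :: "nat \<Rightarrow> complex" where "\<zeta> = (\<lambda>i. if i = 0 then 1 else if i = 1 then of_real c else 0)"
    and "\<eta> = (\<lambda>i. if i = 2 then 1 else if i = 1 then of_real c else 0)"
  have cc: "complex_of_real c * complex_of_real c = 1 / 2"
    using arg_cong[OF c(3), of complex_of_real] by simp
  \<comment> \<open>The null vector, as \<open>2 * c = sqrt 2\<close>.\<close>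
  define x :: "nat \<Rightarrow> complex" where "x = (\<lambda>i. if i = 1 then - of_real (2 * c) else 1)"
  have "psd_kernel {..<3::nat} (\<lambda>i j. Psi \<alpha> \<beta> (\<zeta> i * cnj (\<zeta> j) + \<eta> i * cnj (\<eta> j)))"
    by (rule preserves_psd_kernel[OF assms(1) Psi_0]) (use assms(2) in \<open>auto intro!: psd_kernel_add psd_kernel_rank_one\<close>)
  from psd_kernel_form[OF this, of x]
  have "0 \<le> Re (hform {..<3} (\<lambda>i j. Psi \<alpha> \<beta> (\<zeta> i * cnj (\<zeta> j) + \<eta> i * cnj (\<eta> j))) x)" .
  also have "\<dots> = 4 - 8 * (c * c powr \<alpha>)"
    using Psi_nonneg_real[of 1 \<alpha> \<beta>] Psi_nonneg_real[of c \<alpha> \<beta>] c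
    by (simp add: hform_def numeral_3_eq_3 \<zeta>_def \<eta>_def x_def cc algebra_simps)
  finally have "c * c powr \<alpha> \<le> c * c" using c(3) by linarith
  then have "c powr \<alpha> \<le> c" using c(1) by (simp only: mult_le_cancel_left_pos)
  then have "ln (c powr \<alpha>) \<le> ln c" using c(1) by (subst ln_le_cancel_iff) simp_all
  then have "\<alpha> * ln c \<le> 1 * ln c" using c(1) by (simp add: ln_powr)
  moreover have "ln c < 0" using c(1,2) by simp
  ultimately show ?thesis by (simp only: mult_le_cancel_right_neg)
qed

lemma preserves_psd_Psi_uminus:
  assumes "preserves_psd (Psi \<alpha> \<beta>) n"
  shows "preserves_psd (Psi \<alpha> (- \<beta>)) n"
  unfolding preserves_psd_iff Psi_uminus
proof (intro allI impI)
  fix K assume "psd_kernel {..<n} K"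
  then have "psd_kernel {..<n} (\<lambda>i j. Psi \<alpha> \<beta> (K i j))"
    by (rule assms[unfolded preserves_psd_iff, rule_format])
  then show "psd_kernel {..<n} (\<lambda>i j. cnj (Psi \<alpha> \<beta> (K i j)))"
    by (rule psd_kernel_cnj)
qed

text \<open>Use \<open>k + 3\<close> equally spaced points \<open>t s\<close>, symmetric about the origin and scaled so that
  \<open>1 + t s * t r\<close> is negative only at the two corner positions \<open>{s, r} = {0, N}\<close>.  The image is the
  matrix of the polynomial \<open>(1 + t s * t r) ^ k\<close>, which has degree \<open>k = N - 2\<close> in \<open>s\<close>, plus a
  correction at the corners.  The weights annihilating that degree form a two-dimensional space, with room
  to prescribe the signs of both end weights so that the corners contribute negatively.\<close>

lemma not_preserves_psd_Psi_wrong_parity: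
  assumes "odd (int k - b)" "1 \<le> k" "k + 3 \<le> n"
  shows "\<not> preserves_psd (Psi (real k) (of_int b)) n"
proof
  assume pres: "preserves_psd (Psi (real k) (of_int b)) n"
  define N where "N = k + 2"
  \<comment> \<open>The negative products \<open>(2 * s - N) * (2 * r - N)\<close> equal \<open>- (N * N)\<close> at the corners and are at
    least \<open>- (N * (N - 2))\<close> elsewhere; \<open>M\<close> lies strictly between the two absolute values.\<close>
  define M where "M = real N * (real N - 1)"
  have N: "N \<ge> 3" using assms(2) by (simp add: N_def)
  have NS: "Suc (N - 1) = N" using N by simp
  have M: "M > 0" using N by (simp add: M_def)
  define h where "h = 1 / sqrt M"
  have hh: "h * h = 1 / M" using M by (simp add: h_def)
  define t where "t = (\<lambda>s::nat. h * (2 * real s - real N))"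
  define A where "A = (\<lambda>s r. 1 + t s * t r)"
  define corner where "corner = (\<lambda>s r. (s = 0 \<and> r = N) \<or> (s = N \<and> r = (0::nat)))"
  define e :: real where "e = (- 1) powi b"
  define y where "y = 1 / (real N - 1)"
  have y: "y > 0" using N by (simp add: y_def)
  have e: "e = 1 \<or> e = -1"
    unfolding e_def by (cases "even b") (auto simp: power_int_minus_left)
  have ke: "(-1) ^ k = - e"
    unfolding e_def using assms(1) by (cases "even b") (auto simp: power_int_minus_left)
  have At: "A s r = 1 + (2 * real s - real N) * (2 * real r - real N) / M" for s r
  proof -
    have "t s * t r = h * h * ((2 * real s - real N) * (2 * real r - real N))"
      by (simp add: t_def)
    then show ?thesis by (simp add: A_def hh)
  qed
  have Acorner: "A s r = - y" if "corner s r" for s r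
  proof -
    have "A s r = 1 - real N * real N / M"
      using that unfolding corner_def by (auto simp: At)
    also have "\<dots> = - y"
      using N by (simp add: M_def y_def field_simps)
    finally show ?thesis .
  qed
  have Anonneg: "A s r \<ge> 0" if "s \<le> N" "r \<le> N" "\<not> corner s r" for s r
  proof -
    define p q where "p = 2 * int s - int N" and "q = 2 * int r - int N"
    have pq: "\<bar>p\<bar> \<le> int N" "\<bar>q\<bar> \<le> int N" using that by (auto simp: p_def q_def)
    have "- (int N * (int N - 1)) \<le> p * q"
    proof (cases "\<bar>p\<bar> = int N \<and> \<bar>q\<bar> = int N")
      case True
      then have "s = 0 \<or> s = N" "r = 0 \<or> r = N" unfolding p_def q_def by linarith+
      then have "s = r" using that(3) unfolding corner_def by blast
      then have "0 \<le> p * q" by (simp add: p_def q_def)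
      moreover have "0 \<le> int N * (int N - 1)" using N by simp
      ultimately show ?thesis by linarith
    next
      case False
      then have "\<bar>p\<bar> * \<bar>q\<bar> \<le> int N * (int N - 1)"
      proof (cases "\<bar>p\<bar> = int N")
        case True
        then show ?thesis using False pq by (intro mult_mono) auto
      next
        case False
        then have "\<bar>p\<bar> * \<bar>q\<bar> \<le> (int N - 1) * int N" using pq by (intro mult_mono) auto
        then show ?thesis by (simp add: mult.commute)
      qed
      then show ?thesis by (simp flip: abs_mult)
    qed
    then have "real_of_int (- (int N * (int N - 1))) \<le> real_of_int (p * q)"
      by (simp only: of_int_le_iff)
    then have "- M \<le> (2 * real s - real N) * (2 * real r - real N)"
      by (simp add: M_def p_def q_def)
    then have "- 1 \<le> (2 * real s - real N) * (2 * real r - real N) / M"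
      using M by (simp add: pos_le_divide_eq)
    then show ?thesis by (simp add: At)
  qed
  have entry: "Psi (real k) (of_int b) (of_real (A s r)) =
      of_real (A s r ^ k + (if corner s r then 2 * e * y ^ k else 0))" if sr: "s \<le> N" "r \<le> N" for s r
  proof (cases "corner s r")
    case True
    then have "A s r ^ k = - e * y ^ k"
      using ke by (simp add: Acorner power_minus[of y])
    then show ?thesis
      using True y Psi_neg_real[of "- y" "real k" b]
      by (simp add: Acorner powr_realpow e_def del: of_real_minus)
  next
    case False
    then show ?thesis
      using Psi_nonneg_real[OF Anonneg[OF sr False], of "real k" "of_int b"] assms(2)
      by (simp add: powr_realpow' Anonneg sr)
  qed
  define w where "w = (\<lambda>s. (-1) ^ s * real (N - 1 choose s))"
  \<comment> \<open>The weights are those of the differences of order \<open>N - 1\<close> starting at \<open>0\<close> and at \<open>1\<close>; the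
    factor \<open>c\<close> makes the product of the end weights opposite in sign to the corner correction.\<close>
  define c where "c = - e * (-1) ^ (N - 1)"
  define v where "v = (\<lambda>s. w s + c * (if s = 0 then 0 else w (s - 1)))"
  have v0: "v 0 = 1" by (simp add: v_def w_def)
  have vN: "v N = - e"
    using N by (simp add: v_def w_def c_def mult.assoc flip: power_mult_distrib)
  have annih: "(\<Sum>s\<le>N. v s * A s r ^ k) = 0" for r
  proof -
    define P where "P = [:1 - h * real N * t r, 2 * h * t r:] ^ k"
    have dP: "degree P < N - 1"
      using degree_power_le[of "[:1 - h * real N * t r, 2 * h * t r:]" k]
      by (auto simp: P_def N_def split: if_splits intro: le_less_trans)
    have P: "A s r ^ k = poly P (real s)" for s
      by (simp add: P_def A_def t_def poly_power algebra_simps)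
    have "degree (pcompose P [:1, 1:]) < N - 1" using dP by (simp add: degree_pcompose)
    then have "(\<Sum>s\<le>N - 1. w s * A (Suc s) r ^ k) = 0"
      using alternating_binomial_sum_poly[of "pcompose P [:1, 1:]" "N - 1"]
      by (simp add: w_def P poly_pcompose)
    moreover have "(\<Sum>s\<le>N - 1. w s * A s r ^ k) = 0"
      using alternating_binomial_sum_poly[OF dP] by (simp add: w_def P)
    moreover have "(\<Sum>s\<le>N. v s * A s r ^ k) =
        (\<Sum>s\<le>N. w s * A s r ^ k) + c * (\<Sum>s\<le>N. (if s = 0 then 0 else w (s - 1)) * A s r ^ k)"
      by (simp add: v_def algebra_simps sum.distrib sum_distrib_left)
    moreover have "(\<Sum>s\<le>N. w s * A s r ^ k) = (\<Sum>s\<le>N - 1. w s * A s r ^ k)"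
    proof -
      have "(\<Sum>s\<le>Suc (N - 1). w s * A s r ^ k) = (\<Sum>s\<le>N - 1. w s * A s r ^ k)"
        unfolding sum.atMost_Suc by (simp add: w_def)
      then show ?thesis unfolding NS .
    qed
    moreover have "(\<Sum>s\<le>N. (if s = 0 then 0 else w (s - 1)) * A s r ^ k) = (\<Sum>s\<le>N - 1. w s * A (Suc s) r ^ k)"
    proof -
      have "(\<Sum>s\<le>Suc (N - 1). (if s = 0 then 0 else w (s - 1)) * A s r ^ k) =
          (\<Sum>s\<le>N - 1. w s * A (Suc s) r ^ k)"
        unfolding sum.atMost_Suc_shift by simp
      then show ?thesis unfolding NS .
    qed
    ultimately show ?thesis by simp
  qed
  have "psd_kernel {..N} (\<lambda>s r. Psi (real k) (of_int b) (of_real (A s r)))"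
  proof (rule preserves_psd_kernel[OF pres Psi_0])
    have "psd_kernel {..N} (\<lambda>s r. 1 + of_real (t s) * cnj (of_real (t r)))"
      by (intro psd_kernel_add psd_kernel_one psd_kernel_rank_one)
    then show "psd_kernel {..N} (\<lambda>s r. complex_of_real (A s r))"
      by (simp add: A_def)
  qed (use assms(3) in \<open>auto simp: N_def\<close>)
  from psd_kernel_form[OF this, of "\<lambda>s. of_real (v s)"]
  have "0 \<le> Re (hform {..N} (\<lambda>s r. Psi (real k) (of_int b) (of_real (A s r))) (\<lambda>s. of_real (v s)))" .
  also have "hform {..N} (\<lambda>s r. Psi (real k) (of_int b) (of_real (A s r))) (\<lambda>s. of_real (v s)) =
     hform {..N} (\<lambda>s r. of_real (A s r ^ k + (if corner s r then 2 * e * y ^ k else 0))) (\<lambda>s. of_real (v s))"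
    by (rule hform_cong) (simp only: entry atMost_iff)
  also have "Re \<dots> = (\<Sum>s\<le>N. \<Sum>r\<le>N. (A s r ^ k + (if corner s r then 2 * e * y ^ k else 0)) * v r * v s)"
    by (simp add: hform_def flip: of_real_mult of_real_add of_real_power)
  also have "\<dots> = (\<Sum>s\<le>N. \<Sum>r\<le>N. A s r ^ k * v r * v s) +
      (\<Sum>s\<le>N. \<Sum>r\<le>N. (if corner s r then 2 * e * y ^ k else 0) * v r * v s)"
    by (simp add: algebra_simps sum.distrib)
  also have "(\<Sum>s\<le>N. \<Sum>r\<le>N. A s r ^ k * v r * v s) = (\<Sum>r\<le>N. v r * (\<Sum>s\<le>N. v s * A s r ^ k))"
    by (subst sum.swap) (simp add: sum_distrib_left mult_ac)
  also have "\<dots> = 0" by (simp add: annih)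
  also have "(\<Sum>s\<le>N. \<Sum>r\<le>N. (if corner s r then 2 * e * y ^ k else 0) * v r * v s) =
      (\<Sum>s\<le>N. (if s = 0 then 2 * e * y ^ k * v N * v 0 else 0) + (if s = N then 2 * e * y ^ k * v 0 * v N else 0))"
  proof (intro sum.cong refl)
    fix s assume "s \<in> {..N}"
    have "(\<Sum>r\<le>N. (if corner s r then 2 * e * y ^ k else 0) * v r * v s) =
       (\<Sum>r\<le>N. (if r = N then (if s = 0 then 2 * e * y ^ k * v N * v 0 else 0) else 0) +
               (if r = 0 then (if s = N then 2 * e * y ^ k * v 0 * v N else 0) else 0))"
      using N by (intro sum.cong) (auto simp: corner_def)
    then show "(\<Sum>r\<le>N. (if corner s r then 2 * e * y ^ k else 0) * v r * v s) =
      (if s = 0 then 2 * e * y ^ k * v N * v 0 else 0) + (if s = N then 2 * e * y ^ k * v 0 * v N else 0)"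
      by (simp add: sum.distrib)
  qed
  also have "\<dots> = 4 * e * y ^ k * v 0 * v N" by (simp add: sum.distrib)
  also have "\<dots> = - 4 * y ^ k" using e by (auto simp: v0 vN)
  finally show False using zero_less_power[OF y, of k] by simp
qed

text \<open>The lattice coefficients give the bound involving \<open>m\<close>, and with \<open>m = 0\<close> also \<open>\<alpha> \<ge> b\<close>.  The
  latter leaves, among integers \<open>\<alpha> < n - 2\<close>, only those with \<open>\<alpha> - b\<close> odd.\<close>

lemma preserves_psd_Psi_imp_large_exponent:
  assumes pres: "preserves_psd (Psi \<alpha> (of_int b)) n" and n: "n \<ge> 3" and b: "b \<ge> 0"
    and notin: "\<nexists>j. \<alpha> = of_int b + 2 * real j" and m: "(m + 2) * (m + 3) \<le> 2 * n"
  shows "of_int b + 2 * real m \<le> \<alpha>" and "real n - 2 \<le> \<alpha>"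
proof -
  have nat: "(\<alpha> - of_int b) / 2 \<notin> \<nat>"
    using notin by (auto elim!: Nats_cases simp: field_simps)
  have lower: "of_int b + 2 * real l \<le> \<alpha>" if l: "(l + 2) * (l + 3) \<le> 2 * n" for l
  proof (rule ccontr)
    assume "\<not> of_int b + 2 * real l \<le> \<alpha>"
    then have "(\<alpha> - of_int b) / 2 < real l" by simp
    then obtain k where k: "k \<le> Suc l" "((\<alpha> - of_int b) / 2 gchoose k) < 0"
      using ex_negative_gbinomial[OF nat] by blast
    have "(k + 1) * (k + 2) \<le> (l + 2) * (l + 3)" using k(1) by (intro mult_mono) auto
    then show False
      using preserves_psd_Psi_coefficient[OF pres, of k] k(2) l by linarith
  qed
  show "of_int b + 2 * real m \<le> \<alpha>" by (rule lower[OF m])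
  have ab: "of_int b \<le> \<alpha>" using lower[of 0] n by simp
  have one: "1 \<le> \<alpha>" by (rule preserves_psd_Psi_imp_ge_1[OF pres n])
  show "real n - 2 \<le> \<alpha>"
  proof (rule ccontr)
    assume "\<not> real n - 2 \<le> \<alpha>"
    then have small: "\<alpha> < real (n - 2)" using n by simp
    show False
    proof (cases "\<alpha> \<in> \<nat>")
      case False
      then obtain k where k: "k \<le> Suc (n - 2)" "(\<alpha> gchoose k) < 0"
        using ex_negative_gbinomial small by blast
      have "k < n" using k(1) n by linarith
      then show False using preserves_psd_Psi_real_coefficient[OF pres, of k] k(2) by linarith
    next
      case True
      then obtain k where k: "\<alpha> = real k" by (auto elim: Nats_cases)
      have "odd (int k - b)"
      proof
        assume "even (int k - b)"
        then obtain i where i: "int k - b = 2 * i" by blast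
        have "b \<le> int k" using ab k by (metis of_int_le_iff of_int_of_nat_eq)
        then have "i \<ge> 0" using i by simp
        then have "int k = b + 2 * int (nat i)" using i by simp
        then have "\<alpha> = of_int b + 2 * real (nat i)"
          unfolding k by (metis (no_types, lifting) of_int_add of_int_mult of_int_numeral of_int_of_nat_eq)
        then show False using notin by blast
      qed
      then show False
        using not_preserves_psd_Psi_wrong_parity[of k b n] pres one small k n by auto
    qed
  qed
qed

lemma not_preserves_psd_Psi:
  assumes n: "n \<ge> 3"
    and cases: "\<beta> \<notin> \<int> \<or> \<alpha> < 1 \<or>
          (\<alpha> < max (real n - 2) (\<bar>\<beta>\<bar> + 2 * real_of_int \<lfloor>(sqrt (8 * real n + 1) - 5) / 2\<rfloor>) \<and>
           \<alpha> \<notin> {\<bar>\<beta>\<bar> - 2 + 2 * real k | k. k \<ge> 1})"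
  shows "\<not> preserves_psd (Psi \<alpha> \<beta>) n"
proof
  assume pres: "preserves_psd (Psi \<alpha> \<beta>) n"
  have "\<beta> \<in> \<int>" using preserves_psd_Psi_imp_Ints[OF pres] n by simp
  moreover have "1 \<le> \<alpha>" by (rule preserves_psd_Psi_imp_ge_1[OF pres n])
  ultimately have small: "\<alpha> < max (real n - 2) (\<bar>\<beta>\<bar> + 2 * real_of_int \<lfloor>(sqrt (8 * real n + 1) - 5) / 2\<rfloor>)"
    and notin: "\<alpha> \<notin> {\<bar>\<beta>\<bar> - 2 + 2 * real k | k. k \<ge> 1}"
    using cases by auto
  obtain b where b: "\<bar>\<beta>\<bar> = of_int b" "b \<ge> 0"
    using \<open>\<beta> \<in> \<int>\<close> by (metis Ints_abs Ints_cases abs_ge_zero of_int_0_le_iff)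
  have pres': "preserves_psd (Psi \<alpha> (of_int b)) n"
    using pres preserves_psd_Psi_uminus[OF pres] b(1) by (auto simp: abs_if split: if_splits)
  define m where "m = nat \<lfloor>(sqrt (8 * real n + 1) - 5) / 2\<rfloor>"
  \<comment> \<open>Since \<open>n \<ge> 3\<close> the floor is nonnegative, so nothing is lost in passing to \<open>nat\<close>.\<close>
  have "sqrt (8 * real n + 1) \<ge> sqrt (5\<^sup>2)" using n by (intro real_sqrt_le_mono) simp
  then have floor: "\<lfloor>(sqrt (8 * real n + 1) - 5) / 2\<rfloor> = int m" by (simp add: m_def)
  have "real m \<le> (sqrt (8 * real n + 1) - 5) / 2" using floor by linarith
  then have "(2 * real m + 5)\<^sup>2 \<le> (sqrt (8 * real n + 1))\<^sup>2" by (intro power_mono) auto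
  then have "real ((m + 2) * (m + 3)) \<le> real (2 * n)" by (simp add: power2_eq_square algebra_simps)
  then have m: "(m + 2) * (m + 3) \<le> 2 * n" by (simp only: of_nat_le_iff)
  have "\<nexists>j. \<alpha> = of_int b + 2 * real j"
  proof
    assume "\<exists>j. \<alpha> = of_int b + 2 * real j"
    then obtain j where "\<alpha> = \<bar>\<beta>\<bar> - 2 + 2 * real (Suc j)" by (auto simp: b)
    then have "\<alpha> \<in> {\<bar>\<beta>\<bar> - 2 + 2 * real k | k. k \<ge> 1}"
      by (intro CollectI exI[of _ "Suc j"]) simp
    then show False using notin by blast
  qed
  from preserves_psd_Psi_imp_large_exponent[OF pres' n b(2) this m] small
  show False by (simp add: floor b(1))
qed

theorem theorem3:
  fixes n :: nat and \<alpha> \<beta> :: real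
  assumes "n \<ge> 3"
  shows "(\<beta> \<in> \<int> \<and> (\<alpha>, \<beta>) \<noteq> (0, 0) \<and>
            (\<alpha> \<in> {\<bar>\<beta>\<bar> - 2 + 2 * real k | k. k \<ge> 1} \<or>
             \<alpha> \<ge> max (real n - 2) (\<bar>\<beta>\<bar> + 2 * real n - 6))
          \<longrightarrow> preserves_psd (Psi \<alpha> \<beta>) n)
       \<and> (\<beta> \<notin> \<int> \<or>
          \<alpha> < 1 \<or>
          (1 \<le> \<alpha> \<and>
           \<alpha> < max (real n - 2) (\<bar>\<beta>\<bar> + 2 * real_of_int \<lfloor>(sqrt (8 * real n + 1) - 5) / 2\<rfloor>) \<and>
           \<alpha> \<notin> {\<bar>\<beta>\<bar> - 2 + 2 * real k | k. k \<ge> 1})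
          \<longrightarrow> \<not> preserves_psd (Psi \<alpha> \<beta>) n)"
  using preserves_psd_Psi[OF assms, of \<beta> \<alpha>] not_preserves_psd_Psi[OF assms, of \<beta> \<alpha>] by blast

end
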